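(* Suppose that the following hold (notation in the context). (No anticipation) For all $g$, $t<T$ and $(d_1,\dots,d_T)\in\mathcal{D}$, $Y_{g,t}(d_1,\dots,d_T)$ does not depend on $(d_{t+1},\dots,d_T)$; it is denoted $Y_{g,t}(d_1,\dots,d_t)$. (i.i.d. groups) The variables $\big((Y_{g,1}(d_1),\dots,Y_{g,T}(d_1,\dots,d_T))_{(d_1,\dots,d_T)\in\mathcal{D}},\bm{D}_g\big)_{g\ge1}$ are i.i.d. (Designs with some stayers) $\{d\in\mathcal{D}_1:V(F\mid D_1=d)>0\}\neq\emptyset$. (Parallel trends for the never-treated outcome) For all $t\ge2$, $E[Y_t(\bm{0}_t)-Y_{t-1}(\bm{0}_{t-1})\mid\bm{D}]=E[Y_t(\bm{0}_t)-Y_{t-1}(\bm{0}_{t-1})]$. (Random coefficients distributed-lag linear model) There exists a random vector $B=(\beta_0,\dots,\beta_K)'$ with $E[\|B\|^2]<\infty$ such that $$Y_t(d_1,\dots,d_t)=Y_t(\bm{0}_t)+\sum_{k=0}^{\min(K,t-1)}\beta_k d_{t-k},$$ where $K<T-1$ is known. Then, for all $k\in\{0,\dots,K\}$, $$E\big[\widehat{\beta}_k\big]=E\Big[W^{k,k}\beta_k+\sum_{\substack{k'=0\\k'\neq k}}^{K}W^{k,k'}\beta_{k'}\Big].$$ Moreover, $E[W^{k,k}]=1$ and $E[W^{k,k'}]=0$ for all $k'\neq k$. Finally, if $\mathrm{Cov}(W^{k,k'},\beta_{k'})=0$ for all $k'\in\{0,\dots,K\}$, then $E[\widehat{\beta}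_k]=E[\beta_k]$.
   Context: Setting. A panel of $G$ groups $g=1,\dots,G$ is observed at periods $t=1,\dots,T$. $D_{g,t}$ is the (real-valued) treatment of group $g$ at period $t$, with support $\mathcal{D}_t$; $\bm{D}_g=(D_{g,1},\dots,D_{g,T})$ is the treatment path, with support $\mathcal{D}$ (supports do not depend on $g$). $Y_{g,t}(d_1,\dots,d_T)$ is the potential outcome of group $g$ at $t$ under path $(d_1,\dots,d_T)$; the observed outcome is $Y_{g,t}=Y_{g,t}(D_{g,1},\dots,D_{g,t})$. The index $g$ is omitted when there is no ambiguity, as groups are identically distributed. $\bm{0}_t$ is the vector of $t$ zeros. $F=\min\{t\ge2:D_t\neq D_1\}$, with $F=T+1$ if the treatment never changes. Each group $g$ has its own random vector $B_g=(\beta_{g,0},\dots,\beta_{g,K})'$ in the random coefficients model, these being part of the i.i.d. group-level variables; no restriction is put on the dependence between $B_g$ and $\bm{D}_g$. Potential outcomes are understood to be defined for the zero path. Distributed-lag two-way fixed effects estimator. $\widehat{\beta}_k$ is the coefficient on $D_{g,t-k}$ in the OLS regression, on the sample of cells $(g,t)$ with $g\in\{1,\dots,G\}$ and $K+1\le t\le T$, of $Y_{g,t}$ on group fixed effects, period fixed effects and $(D_{g,t-k})_{k\in\{0,\dots,K\}}$. Weights. $\eta^k_{g,t}$ ($t\ge K+1$) is the sample residual of cell $(g,t)$ in the OLS regression, on the same sample, of $D_{g,t-k}$ on group and period fixed effects and $(D_{g,t-k'})_{k'\in\{0,\dots,K\},\,k'\neq k}$. For $(k,k')\in\{0,\dots,K\}^2$,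 $$W^{k,k'}_g=\frac{\sum_{t\ge K+1}\eta^k_{g,t}D_{g,t-k'}}{(1/G)\sum_{g'=1}^G\sum_{t\ge K+1}\eta^k_{g',t}D_{g',t-k}}.$$ The distribution of $W^{k,k'}_g$ (jointly with $B_g$) does not depend on $g$, so the index $g$ is dropped. It is implicitly understood that the regression coefficients are well defined (the denominators above are nonzero) and that the expectations and covariances written (including those of $Y_t(\bm{0}_t)$) exist. *)

theory Defs
  imports "HOL-Probability.Probability"
begin

text \<open>Observations \<open>s \<in> S\<close>, regressors \<open>j \<in> J\<close>, outcome \<open>y s\<close>, regressor values \<open>x j s\<close>.
  The coefficient on \<open>j\<close> is well defined when all least-squares fits agree on it, even if other
  coefficients (such as those on collinear fixed effects) are not unique; residuals are always
  unique.\<close>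

definition ssr :: "'s set \<Rightarrow> 'r set \<Rightarrow> ('r \<Rightarrow> 's \<Rightarrow> real) \<Rightarrow> ('s \<Rightarrow> real) \<Rightarrow> ('r \<Rightarrow> real) \<Rightarrow> real" where
  "ssr S J x y c = (\<Sum>s\<in>S. (y s - (\<Sum>j\<in>J. c j * x j s))\<^sup>2)"

definition is_ols_fit ::
  "'s set \<Rightarrow> 'r set \<Rightarrow> ('r \<Rightarrow> 's \<Rightarrow> real) \<Rightarrow> ('s \<Rightarrow> real) \<Rightarrow> ('r \<Rightarrow> real) \<Rightarrow> bool" where
  "is_ols_fit S J x y c \<longleftrightarrow> (\<forall>c'. ssr S J x y c \<le> ssr S J x y c')"

definition ols_coef ::
  "'s set \<Rightarrow> 'r set \<Rightarrow> ('r \<Rightarrow> 's \<Rightarrow> real) \<Rightarrow> ('s \<Rightarrow> real) \<Rightarrow> 'r \<Rightarrow> real" where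
  "ols_coef S J x y j = (THE b. \<exists>c. is_ols_fit S J x y c \<and> b = c j)"

definition ols_resid ::
  "'s set \<Rightarrow> 'r set \<Rightarrow> ('r \<Rightarrow> 's \<Rightarrow> real) \<Rightarrow> ('s \<Rightarrow> real) \<Rightarrow> 's \<Rightarrow> real" where
  "ols_resid S J x y s = (THE e. \<exists>c. is_ols_fit S J x y c \<and> e = y s - (\<Sum>j\<in>J. c j * x j s))"

text \<open>In the regression, \<open>D g t\<close> and \<open>Y g t\<close> are realized values (numbers).\<close>

datatype regressor = GroupFE nat | PeriodFE nat | Lag nat

fun regressor_value :: "(nat \<Rightarrow> nat \<Rightarrow> real) \<Rightarrow> regressor \<Rightarrow> nat \<times> nat \<Rightarrow> real" where
  "regressor_value D (GroupFE g') (g, t) = of_bool (g = g')"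
| "regressor_value D (PeriodFE t') (g, t) = of_bool (t = t')"
| "regressor_value D (Lag k) (g, t) = D g (t - k)"

definition cells :: "nat \<Rightarrow> nat \<Rightarrow> nat \<Rightarrow> (nat \<times> nat) set" where
  "cells G T K = {1..G} \<times> {K+1..T}"

definition regressors :: "nat \<Rightarrow> nat \<Rightarrow> nat \<Rightarrow> regressor set" where
  "regressors G T K = GroupFE ` {1..G} \<union> PeriodFE ` {K+1..T} \<union> Lag ` {0..K}"

definition dl_twfe ::
  "nat \<Rightarrow> nat \<Rightarrow> nat \<Rightarrow> (nat \<Rightarrow> nat \<Rightarrow> real) \<Rightarrow> (nat \<Rightarrow> nat \<Rightarrow> real) \<Rightarrow> nat \<Rightarrow> real" where
  "dl_twfe G T K D Y k =
     ols_coef (cells G T K) (regressors G T K) (regressor_value D) (\<lambda>(g, t). Y g t) (Lag k)"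

definition eta :: "nat \<Rightarrow> nat \<Rightarrow> nat \<Rightarrow> (nat \<Rightarrow> nat \<Rightarrow> real) \<Rightarrow> nat \<Rightarrow> nat \<Rightarrow> nat \<Rightarrow> real" where
  "eta G T K D k g t =
     ols_resid (cells G T K) (regressors G T K - {Lag k}) (regressor_value D)
       (\<lambda>(g, t). D g (t - k)) (g, t)"

definition weight_denom :: "nat \<Rightarrow> nat \<Rightarrow> nat \<Rightarrow> (nat \<Rightarrow> nat \<Rightarrow> real) \<Rightarrow> nat \<Rightarrow> real" where
  "weight_denom G T K D k =
     (1 / real G) * (\<Sum>g=1..G. \<Sum>t=K+1..T. eta G T K D k g t * D g (t - k))"

definition weight ::
  "nat \<Rightarrow> nat \<Rightarrow> nat \<Rightarrow> (nat \<Rightarrow> nat \<Rightarrow> real) \<Rightarrow> nat \<Rightarrow> nat \<Rightarrow> nat \<Rightarrow> real" where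
  "weight G T K D k k' g =
     (\<Sum>t=K+1..T. eta G T K D k g t * D g (t - k')) / weight_denom G T K D k"

text \<open>From here on \<open>D g t\<close> is a random variable. A treatment path is a function that is extensional
  on \<open>{1..T}\<close>, and \<open>Y g t d\<close> is the (random) potential outcome of group \<open>g\<close> at period \<open>t\<close> under the
  full path \<open>d\<close>. Supports are topological supports.\<close>

definition treatment_path :: "nat \<Rightarrow> (nat \<Rightarrow> 'w \<Rightarrow> real) \<Rightarrow> 'w \<Rightarrow> (nat \<Rightarrow> real)" where
  "treatment_path T X \<omega> = (\<lambda>t\<in>{1..T}. X t \<omega>)"

definition zero_path :: "nat \<Rightarrow> (nat \<Rightarrow> real)" where
  "zero_path T = (\<lambda>t\<in>{1..T}. 0)"

definition path_support :: "'w measure \<Rightarrow> nat \<Rightarrow> (nat \<Rightarrow> 'w \<Rightarrow> real) \<Rightarrow> (nat \<Rightarrow> real) set" where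
  "path_support M T X =
     {d \<in> {1..T} \<rightarrow>\<^sub>E UNIV.
        \<forall>e>0. measure M {\<omega> \<in> space M. \<forall>t\<in>{1..T}. \<bar>X t \<omega> - d t\<bar> < e} > 0}"

definition real_support :: "'w measure \<Rightarrow> ('w \<Rightarrow> real) \<Rightarrow> real set" where
  "real_support M X = {x. \<forall>e>0. measure M {\<omega> \<in> space M. \<bar>X \<omega> - x\<bar> < e} > 0}"

text \<open>Potential outcomes are also defined for the zero path, which may lie outside the support. Groups
  are identically distributed, so the support of group 1 is the common one.\<close>

definition admissible_paths ::
  "'w measure \<Rightarrow> nat \<Rightarrow> (nat \<Rightarrow> nat \<Rightarrow> 'w \<Rightarrow> real) \<Rightarrow> (nat \<Rightarrow> real) set" where
  "admissible_paths M T D = insert (zero_path T) (path_support M T (D 1))"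

definition observed_outcome ::
  "nat \<Rightarrow> (nat \<Rightarrow> nat \<Rightarrow> 'w \<Rightarrow> real) \<Rightarrow> (nat \<Rightarrow> nat \<Rightarrow> (nat \<Rightarrow> real) \<Rightarrow> 'w \<Rightarrow> real)
     \<Rightarrow> nat \<Rightarrow> nat \<Rightarrow> 'w \<Rightarrow> real" where
  "observed_outcome T D Y g t \<omega> = Y g t (treatment_path T (D g) \<omega>) \<omega>"

definition beta_hat ::
  "nat \<Rightarrow> nat \<Rightarrow> nat \<Rightarrow> (nat \<Rightarrow> nat \<Rightarrow> 'w \<Rightarrow> real) \<Rightarrow> (nat \<Rightarrow> nat \<Rightarrow> (nat \<Rightarrow> real) \<Rightarrow> 'w \<Rightarrow> real)
     \<Rightarrow> nat \<Rightarrow> 'w \<Rightarrow> real" where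
  "beta_hat G T K D Y k \<omega> =
     dl_twfe G T K (\<lambda>g t. D g t \<omega>) (\<lambda>g t. observed_outcome T D Y g t \<omega>) k"

definition W ::
  "nat \<Rightarrow> nat \<Rightarrow> nat \<Rightarrow> (nat \<Rightarrow> nat \<Rightarrow> 'w \<Rightarrow> real) \<Rightarrow> nat \<Rightarrow> nat \<Rightarrow> nat \<Rightarrow> 'w \<Rightarrow> real" where
  "W G T K D k k' g \<omega> = weight G T K (\<lambda>g t. D g t \<omega>) k k' g"

text \<open>Almost-sure statements about potential outcomes hold outside one null event common to all paths,
  because the observed outcome evaluates them at a random path.\<close>

definition no_anticipation ::
  "'w measure \<Rightarrow> nat \<Rightarrow> (nat \<Rightarrow> nat \<Rightarrow> 'w \<Rightarrow> real) \<Rightarrow> (nat \<Rightarrow> nat \<Rightarrow> (nat \<Rightarrow> real) \<Rightarrow> 'w \<Rightarrow> real)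
     \<Rightarrow> bool" where
  "no_anticipation M T D Y \<longleftrightarrow>
     (\<forall>g\<ge>1. AE \<omega> in M. \<forall>t\<in>{1..<T}. \<forall>d\<in>admissible_paths M T D. \<forall>d'\<in>admissible_paths M T D.
        (\<forall>s\<in>{1..t}. d s = d' s) \<longrightarrow> Y g t d \<omega> = Y g t d' \<omega>)"

definition group_space ::
  "nat \<Rightarrow> nat \<Rightarrow> (nat \<Rightarrow> real) set
     \<Rightarrow> ((nat \<times> (nat \<Rightarrow> real) \<Rightarrow> real) \<times> (nat \<Rightarrow> real) \<times> (nat \<Rightarrow> real)) measure" where
  "group_space T K P =
     (\<Pi>\<^sub>M i\<in>{1..T} \<times> P. borel) \<Otimes>\<^sub>M ((\<Pi>\<^sub>M t\<in>{1..T}. borel) \<Otimes>\<^sub>M (\<Pi>\<^sub>M k\<in>{0..K}. borel))"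

definition group_variable ::
  "nat \<Rightarrow> nat \<Rightarrow> (nat \<Rightarrow> real) set \<Rightarrow> (nat \<Rightarrow> nat \<Rightarrow> 'w \<Rightarrow> real)
     \<Rightarrow> (nat \<Rightarrow> nat \<Rightarrow> (nat \<Rightarrow> real) \<Rightarrow> 'w \<Rightarrow> real) \<Rightarrow> (nat \<Rightarrow> nat \<Rightarrow> 'w \<Rightarrow> real) \<Rightarrow> nat \<Rightarrow> 'w
     \<Rightarrow> (nat \<times> (nat \<Rightarrow> real) \<Rightarrow> real) \<times> (nat \<Rightarrow> real) \<times> (nat \<Rightarrow> real)" where
  "group_variable T K P D Y \<beta> g \<omega> =
     ((\<lambda>(t, d)\<in>{1..T} \<times> P. Y g t d \<omega>), treatment_path T (D g) \<omega>, (\<lambda>k\<in>{0..K}. \<beta> g k \<omega>))"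

definition iid_groups ::
  "'w measure \<Rightarrow> nat \<Rightarrow> nat \<Rightarrow> (nat \<Rightarrow> nat \<Rightarrow> 'w \<Rightarrow> real)
     \<Rightarrow> (nat \<Rightarrow> nat \<Rightarrow> (nat \<Rightarrow> real) \<Rightarrow> 'w \<Rightarrow> real) \<Rightarrow> (nat \<Rightarrow> nat \<Rightarrow> 'w \<Rightarrow> real) \<Rightarrow> bool" where
  "iid_groups M T K D Y \<beta> \<longleftrightarrow>
     (let P = admissible_paths M T D; N = group_space T K P; Z = group_variable T K P D Y \<beta> in
        prob_space.indep_vars M (\<lambda>_. N) Z {1..} \<and> (\<forall>g\<ge>1. distr M N (Z g) = distr M N (Z 1)))"

definition first_change :: "nat \<Rightarrow> (nat \<Rightarrow> 'w \<Rightarrow> real) \<Rightarrow> 'w \<Rightarrow> nat" where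
  "first_change T X \<omega> = (LEAST t. t = T + 1 \<or> (2 \<le> t \<and> t \<le> T \<and> X t \<omega> \<noteq> X 1 \<omega>))"

text \<open>\<open>v\<close> is a version of the function \<open>x \<mapsto> V(Z | X = x)\<close>, which is determined up to a null set of the
  law of \<open>X\<close>.\<close>

definition cond_var_version ::
  "'w measure \<Rightarrow> ('w \<Rightarrow> real) \<Rightarrow> ('w \<Rightarrow> real) \<Rightarrow> (real \<Rightarrow> real) \<Rightarrow> bool" where
  "cond_var_version M X Z v \<longleftrightarrow>
     v \<in> borel_measurable borel \<and>
     (let A = vimage_algebra (space M) X borel in
        AE \<omega> in M. v (X \<omega>) = real_cond_exp M A (\<lambda>\<omega>'. (Z \<omega>' - real_cond_exp M A Z \<omega>')\<^sup>2) \<omega>)"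

text \<open>Quantifying over all versions makes the condition independent of the choice of version. Requiring
  it for only one version would be vacuous when \<open>D\<^sub>1\<close> has no atoms.\<close>

definition some_stayers :: "'w measure \<Rightarrow> nat \<Rightarrow> (nat \<Rightarrow> nat \<Rightarrow> 'w \<Rightarrow> real) \<Rightarrow> bool" where
  "some_stayers M T D \<longleftrightarrow>
     (\<forall>g\<ge>1. \<forall>v. cond_var_version M (D g 1) (\<lambda>\<omega>. real (first_change T (D g) \<omega>)) v \<longrightarrow>
        {d \<in> real_support M (D g 1). v d > 0} \<noteq> {})"

definition parallel_trends ::
  "'w measure \<Rightarrow> nat \<Rightarrow> (nat \<Rightarrow> nat \<Rightarrow> 'w \<Rightarrow> real) \<Rightarrow> (nat \<Rightarrow> nat \<Rightarrow> (nat \<Rightarrow> real) \<Rightarrow> 'w \<Rightarrow> real)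
     \<Rightarrow> bool" where
  "parallel_trends M T D Y \<longleftrightarrow>
     (\<forall>g\<ge>1. \<forall>t\<in>{2..T}.
        (let \<Delta> = (\<lambda>\<omega>. Y g t (zero_path T) \<omega> - Y g (t - 1) (zero_path T) \<omega>);
             A = vimage_algebra (space M) (treatment_path T (D g)) (\<Pi>\<^sub>M s\<in>{1..T}. borel)
         in AE \<omega> in M. real_cond_exp M A \<Delta> \<omega> = (\<integral>\<omega>'. \<Delta> \<omega>' \<partial>M)))"

definition random_coef_dl_model ::
  "'w measure \<Rightarrow> nat \<Rightarrow> nat \<Rightarrow> (nat \<Rightarrow> nat \<Rightarrow> 'w \<Rightarrow> real)
     \<Rightarrow> (nat \<Rightarrow> nat \<Rightarrow> (nat \<Rightarrow> real) \<Rightarrow> 'w \<Rightarrow> real) \<Rightarrow> (nat \<Rightarrow> nat \<Rightarrow> 'w \<Rightarrow> real) \<Rightarrow> bool" where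
  "random_coef_dl_model M T K D Y \<beta> \<longleftrightarrow>
     (\<forall>g\<ge>1.
        (\<forall>k\<in>{0..K}. \<beta> g k \<in> borel_measurable M) \<and>
        integrable M (\<lambda>\<omega>. \<Sum>k=0..K. (\<beta> g k \<omega>)\<^sup>2) \<and>
        (AE \<omega> in M. \<forall>t\<in>{1..T}. \<forall>d\<in>admissible_paths M T D.
           Y g t d \<omega> = Y g t (zero_path T) \<omega> + (\<Sum>k=0..min K (t - 1). \<beta> g k \<omega> * d (t - k))))"

definition cov :: "'w measure \<Rightarrow> ('w \<Rightarrow> real) \<Rightarrow> ('w \<Rightarrow> real) \<Rightarrow> real" where
  "cov M X Z = (\<integral>\<omega>. (X \<omega> - (\<integral>\<omega>'. X \<omega>' \<partial>M)) * (Z \<omega> - (\<integral>\<omega>'. Z \<omega>' \<partial>M)) \<partial>M)"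

end

theory Submission
  imports Defs "HOL-Combinatorics.Permutations"
begin

text \<open>By the Frisch--Waugh--Lovell theorem, and since the paths of treatments lie almost surely in
  their support, the estimator splits almost surely into
  \<open>(1 / G) * (\<Sum>g. \<Sum>k'. W\<^sub>g * \<beta>\<^sub>g)\<close> and a linear combination \<open>R\<close> of the never-treated outcomes whose
  weights depend on the treatment paths only and sum to 0 over periods and over groups.

  Parallel trends and independence across groups make the mean of \<open>Y\<^sub>t(0) - Y\<^sub>1(0)\<close> given all paths a
  constant that depends on \<open>t\<close> only, so the two zero sums give \<open>E R = 0\<close>. As the weights are unbounded,
  this is shown on the events where they are at most \<open>n\<close>, and \<open>n\<close> tends to infinity by dominated
  convergence.

  Permuting the groups preserves the joint law and permutes the weights \<open>W\<^sub>g\<close>, so expectations that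
  involve group \<open>g\<close> do not depend on \<open>g\<close>. The mean of \<open>W\<^sub>g\<close> over \<open>g\<close> is 1 for the own lag by
  normalization, and 0 for the other lags by orthogonality of the residuals.\<close>

subsection \<open>Least squares\<close>

text \<open>The normal equations. Existence, uniqueness of fitted values and relabelling are argued
  on these linear equations instead of on the minimization in \<open>is_ols_fit\<close>.\<close>

definition orth_fit :: "'s set \<Rightarrow> 'r set \<Rightarrow> ('r \<Rightarrow> 's \<Rightarrow> real) \<Rightarrow> ('s \<Rightarrow> real) \<Rightarrow> ('r \<Rightarrow> real) \<Rightarrow> bool" where
  "orth_fit S J x y c \<longleftrightarrow> (\<forall>i\<in>J. (\<Sum>s\<in>S. (y s - (\<Sum>j\<in>J. c j * x j s)) * x i s) = 0)"

lemma orth_fit_span: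
  assumes "orth_fit S J x y c"
  shows "(\<Sum>s\<in>S. (y s - (\<Sum>j\<in>J. c j * x j s)) * (\<Sum>i\<in>J. b i * x i s)) = 0"
proof -
  have "(\<Sum>s\<in>S. (y s - (\<Sum>j\<in>J. c j * x j s)) * (\<Sum>i\<in>J. b i * x i s))
      = (\<Sum>i\<in>J. \<Sum>s\<in>S. (y s - (\<Sum>j\<in>J. c j * x j s)) * (b i * x i s))"
    by (subst sum.swap) (simp add: sum_distrib_left)
  also have "\<dots> = (\<Sum>i\<in>J. b i * (\<Sum>s\<in>S. (y s - (\<Sum>j\<in>J. c j * x j s)) * x i s))"
    by (simp add: sum_distrib_left mult_ac)
  also have "\<dots> = 0"
    using assms by (simp add: orth_fit_def)
  finally show ?thesis .
qed

text \<open>Two fits differ by an element of the span of the regressors, to which the residual of an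
  orthogonal fit is perpendicular, so the cross term drops out.\<close>

lemma ssr_pythagoras:
  assumes "orth_fit S J x y c"
  shows "ssr S J x y c' = ssr S J x y c + (\<Sum>s\<in>S. (\<Sum>j\<in>J. (c j - c' j) * x j s)\<^sup>2)"
proof -
  define e where "e s = y s - (\<Sum>j\<in>J. c j * x j s)" for s
  define u where "u s = (\<Sum>j\<in>J. (c j - c' j) * x j s)" for s
  have "y s - (\<Sum>j\<in>J. c' j * x j s) = e s + u s" for s
    by (simp add: e_def u_def left_diff_distrib sum_subtractf)
  then have "ssr S J x y c' = (\<Sum>s\<in>S. (e s)\<^sup>2 + 2 * (e s * u s) + (u s)\<^sup>2)"
    by (simp add: ssr_def power2_sum algebra_simps)
  also have "\<dots> = (\<Sum>s\<in>S. (e s)\<^sup>2) + 2 * (\<Sum>s\<in>S. e s * u s) + (\<Sum>s\<in>S. (u s)\<^sup>2)"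
    by (simp add: sum.distrib sum_distrib_left)
  also have "(\<Sum>s\<in>S. e s * u s) = 0"
    unfolding e_def u_def using orth_fit_span[OF assms] .
  finally show ?thesis
    by (simp add: ssr_def e_def u_def)
qed

lemma orth_fit_is_ols_fit:
  assumes "orth_fit S J x y c"
  shows "is_ols_fit S J x y c"
  unfolding is_ols_fit_def
proof
  show "ssr S J x y c \<le> ssr S J x y c'" for c'
    by (subst ssr_pythagoras[OF assms, of c']) (simp add: sum_nonneg)
qed

text \<open>A second minimizer leaves no room for the extra sum of squares in
  \<open>ssr_pythagoras\<close>. Fitted values on \<open>S\<close> are therefore unique even when
  collinear fixed effects leave \<open>c\<close> undetermined, which makes \<open>ols_resid\<close>
  well defined.\<close>

lemma ols_fit_eq:
  assumes "finite S" "orth_fit S J x y c" "is_ols_fit S J x y c'" "s \<in> S"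
  shows "(\<Sum>j\<in>J. c' j * x j s) = (\<Sum>j\<in>J. c j * x j s)"
proof -
  have "ssr S J x y c' \<le> ssr S J x y c"
    using assms(3) unfolding is_ols_fit_def by blast
  then have "(\<Sum>s\<in>S. (\<Sum>j\<in>J. (c j - c' j) * x j s)\<^sup>2) \<le> 0"
    using ssr_pythagoras[OF assms(2), of c'] by linarith
  then have "(\<Sum>s\<in>S. (\<Sum>j\<in>J. (c j - c' j) * x j s)\<^sup>2) = 0"
    by (simp add: sum_nonneg order_antisym)
  then have "(\<Sum>j\<in>J. (c j - c' j) * x j s) = 0"
    using assms(1,4) by (simp add: sum_nonneg_eq_0_iff)
  then show ?thesis
    by (simp add: left_diff_distrib sum_subtractf)
qed

lemma ols_resid_eq:
  assumes "finite S" "orth_fit S J x y c" "s \<in> S"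
  shows "ols_resid S J x y s = y s - (\<Sum>j\<in>J. c j * x j s)"
  unfolding ols_resid_def
proof (rule the_equality)
  show "\<exists>c'. is_ols_fit S J x y c' \<and>
      y s - (\<Sum>j\<in>J. c j * x j s) = y s - (\<Sum>j\<in>J. c' j * x j s)"
    using orth_fit_is_ols_fit[OF assms(2)] by blast
next
  fix e
  assume "\<exists>c'. is_ols_fit S J x y c' \<and> e = y s - (\<Sum>j\<in>J. c' j * x j s)"
  then show "e = y s - (\<Sum>j\<in>J. c j * x j s)"
    using ols_fit_eq[OF assms(1,2) _ assms(3)] by force
qed

text \<open>Residuals by Gram--Schmidt elimination of one regressor at a time. A regressor that is collinear
  with the earlier ones has residual 0 on \<open>S\<close>, and \<open>0 / 0 = 0\<close> then skips it. Unlike the normal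
  equations, this form is visibly measurable in the regressors, whatever their rank.\<close>

fun gs_resid :: "'s set \<Rightarrow> ('r \<Rightarrow> 's \<Rightarrow> real) \<Rightarrow> 'r list \<Rightarrow> ('s \<Rightarrow> real) \<Rightarrow> 's \<Rightarrow> real" where
  "gs_resid S x [] y s = y s"
| "gs_resid S x (j # js) y s = gs_resid S x js y s
     - (\<Sum>u\<in>S. gs_resid S x js y u * gs_resid S x js (x j) u)
       / (\<Sum>u\<in>S. gs_resid S x js (x j) u * gs_resid S x js (x j) u) * gs_resid S x js (x j) s"

text \<open>The induction runs over all outcomes at once, because each stage residualizes both
  \<open>y\<close> and the new regressor \<open>x j\<close> against the earlier ones. It also yields
  a solution of the normal equations for any rank.\<close>

lemma gs_resid_orth_fit:
  assumes "finite S" "distinct js"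
  shows "\<exists>c. orth_fit S (set js) x y c \<and>
    (\<forall>s. gs_resid S x js y s = y s - (\<Sum>j\<in>set js. c j * x j s))"
  using assms(2)
proof (induction js arbitrary: y)
  case Nil
  then show ?case by (simp add: orth_fit_def)
next
  case (Cons j js)
  obtain c where c: "orth_fit S (set js) x y c"
    "\<And>s. gs_resid S x js y s = y s - (\<Sum>i\<in>set js. c i * x i s)"
    using Cons by fastforce
  obtain a where a: "orth_fit S (set js) x (x j) a"
    "\<And>s. gs_resid S x js (x j) s = x j s - (\<Sum>i\<in>set js. a i * x i s)"
    using Cons by fastforce
  define r where "r = gs_resid S x js y"
  define e where "e = gs_resid S x js (x j)"
  define q where "q = (\<Sum>u\<in>S. r u * e u) / (\<Sum>u\<in>S. e u * e u)"
  \<comment> \<open>Expanding \<open>r - q * e\<close> in the regressors puts \<open>q\<close> on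
    \<open>x j\<close> and corrects each earlier coefficient by \<open>q * a i\<close>.\<close>
  define c' where "c' i = (if i = j then q else c i - q * a i)" for i
  have j: "j \<notin> set js" using Cons.prems by simp
  have gs: "gs_resid S x (j # js) y s = r s - q * e s" for s
    by (simp add: r_def e_def q_def)
  have "(\<Sum>i\<in>set js. c' i * x i s) = (\<Sum>i\<in>set js. c i * x i s) - q * (\<Sum>i\<in>set js. a i * x i s)" for s
  proof -
    have "(\<Sum>i\<in>set js. c' i * x i s) = (\<Sum>i\<in>set js. (c i - q * a i) * x i s)"
      using j by (intro sum.cong) (auto simp: c'_def)
    then show ?thesis
      by (simp add: left_diff_distrib sum_subtractf sum_distrib_left mult.assoc)
  qed
  then have rep: "gs_resid S x (j # js) y s = y s - (\<Sum>i\<in>set (j # js). c' i * x i s)" for s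
    using j by (simp add: gs r_def e_def c(2) a(2) c'_def[of j] right_diff_distrib del: gs_resid.simps)
  have r0: "(\<Sum>s\<in>S. r s * x i s) = 0" if "i \<in> set js" for i
    using c(1) that by (simp add: orth_fit_def r_def c(2))
  have e0: "(\<Sum>s\<in>S. e s * x i s) = 0" if "i \<in> set js" for i
    using a(1) that by (simp add: orth_fit_def e_def a(2))
  have old: "(\<Sum>s\<in>S. (r s - q * e s) * x i s) = 0" if "i \<in> set js" for i
    using r0[OF that] e0[OF that]
    by (simp add: left_diff_distrib sum_subtractf mult.assoc flip: sum_distrib_left)
  \<comment> \<open>Since \<open>x j\<close> and \<open>e\<close> differ by earlier regressors, to
    which \<open>r - q * e\<close> is already orthogonal, orthogonality to \<open>x j\<close>
    reduces to orthogonality to \<open>e\<close>.\<close>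
  have xj: "x j s = e s + (\<Sum>i\<in>set js. a i * x i s)" for s
    by (simp add: e_def a(2))
  have "(\<Sum>s\<in>S. (r s - q * e s) * (\<Sum>i\<in>set js. a i * x i s)) = 0"
  proof -
    have "(\<Sum>s\<in>S. (r s - q * e s) * (\<Sum>i\<in>set js. a i * x i s))
        = (\<Sum>i\<in>set js. \<Sum>s\<in>S. (r s - q * e s) * (a i * x i s))"
      by (subst sum.swap) (simp add: sum_distrib_left)
    also have "\<dots> = (\<Sum>i\<in>set js. a i * (\<Sum>s\<in>S. (r s - q * e s) * x i s))"
      by (simp add: sum_distrib_left mult_ac)
    finally show ?thesis by (simp add: old)
  qed
  then have "(\<Sum>s\<in>S. (r s - q * e s) * x j s) = (\<Sum>s\<in>S. (r s - q * e s) * e s)"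
    unfolding xj by (simp add: distrib_left sum.distrib)
  also have "\<dots> = (\<Sum>s\<in>S. r s * e s) - q * (\<Sum>s\<in>S. e s * e s)"
    by (simp add: left_diff_distrib sum_subtractf mult.assoc sum_distrib_left)
  also have "\<dots> = 0"
  proof (cases "(\<Sum>s\<in>S. e s * e s) = 0")
    case True
    then have "\<And>s. s \<in> S \<Longrightarrow> e s = 0"
      using assms(1) by (simp add: sum_nonneg_eq_0_iff)
    then show ?thesis by simp
  qed (simp add: q_def)
  finally have "\<forall>i\<in>set (j # js). (\<Sum>s\<in>S. (r s - q * e s) * x i s) = 0"
    using old by simp
  then have "orth_fit S (set (j # js)) x y c'"
    unfolding orth_fit_def rep[symmetric] gs by blast
  then show ?case using rep by blast
qed

lemma gs_resid_measurable:
  assumes "\<And>j s. j \<in> set js \<Longrightarrow> s \<in> S \<Longrightarrow> (\<lambda>z. x z j s) \<in> borel_measurable L"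
    and "\<And>s. s \<in> S \<Longrightarrow> (\<lambda>z. y z s) \<in> borel_measurable L"
    and "s \<in> S"
  shows "(\<lambda>z. gs_resid S (x z) js (y z) s) \<in> borel_measurable L"
  using assms
proof (induction js arbitrary: y s)
  case (Cons j js)
  have [measurable]: "(\<lambda>z. gs_resid S (x z) js (y z) u) \<in> borel_measurable L"
    "(\<lambda>z. gs_resid S (x z) js (x z j) u) \<in> borel_measurable L" if "u \<in> S" for u
    by (rule Cons.IH; use Cons.prems that in simp)+
  show ?case
    unfolding gs_resid.simps using \<open>s \<in> S\<close> by measurable
qed simp

lemma ex_orth_fit:
  assumes "finite S" "finite J"
  shows "\<exists>c. orth_fit S J x y c"
  using gs_resid_orth_fit[OF assms(1)] finite_distinct_list[OF assms(2)] by metis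

text \<open>The defining \<open>THE\<close> says nothing about measurability in \<open>z\<close>. By
  uniqueness of residuals it may be replaced by Gram-Schmidt elimination in an order
  \<open>js\<close> that is the same for all \<open>z\<close>.\<close>

lemma ols_resid_measurable:
  assumes "finite S" "finite J"
    and "\<And>j s. j \<in> J \<Longrightarrow> s \<in> S \<Longrightarrow> (\<lambda>z. x z j s) \<in> borel_measurable L"
    and "\<And>s. s \<in> S \<Longrightarrow> (\<lambda>z. y z s) \<in> borel_measurable L"
    and "s \<in> S"
  shows "(\<lambda>z. ols_resid S J (x z) (y z) s) \<in> borel_measurable L"
proof -
  obtain js where js: "set js = J" "distinct js"
    using finite_distinct_list[OF assms(2)] by blast
  have "ols_resid S J (x z) (y z) s = gs_resid S (x z) js (y z) s" for z
    using gs_resid_orth_fit[OF assms(1) js(2), of "x z" "y z"] ols_resid_eq[OF assms(1) _ assms(5)]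
    by (auto simp: js(1))
  then show ?thesis
    using gs_resid_measurable[of js S x L y s] assms js by simp
qed

lemma ols_resid_orth:
  assumes "finite S" "finite J" "i \<in> J"
  shows "(\<Sum>s\<in>S. ols_resid S J x y s * x i s) = 0"
proof -
  obtain c where "orth_fit S J x y c"
    using ex_orth_fit[OF assms(1,2)] by blast
  then show ?thesis
    using assms(3) by (simp add: ols_resid_eq[OF assms(1)] orth_fit_def)
qed

text \<open>The residual \<open>e\<close> is a combination of all regressors with coefficient 1 on
  \<open>k\<close>. Testing the normal equations of the full regression against \<open>e\<close>
  removes every coefficient except that of \<open>k\<close>, so all fits agree on it, whatever the
  others are.\<close>

lemma frisch_waugh_lovell:
  fixes x :: "'r \<Rightarrow> 's \<Rightarrow> real"
  assumes "finite S" "finite J" "k \<in> J"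
  defines "e \<equiv> ols_resid S (J - {k}) x (x k)"
  assumes nz: "(\<Sum>s\<in>S. e s * x k s) \<noteq> 0"
  shows "ols_coef S J x y k = (\<Sum>s\<in>S. e s * y s) / (\<Sum>s\<in>S. e s * x k s)"
proof -
  have e0: "(\<Sum>s\<in>S. e s * x i s) = 0" if "i \<in> J - {k}" for i
    unfolding e_def using that assms by (intro ols_resid_orth) auto
  obtain a where a: "orth_fit S (J - {k}) x (x k) a"
    using ex_orth_fit assms by blast
  have e_eq: "e s = (\<Sum>j\<in>J. (if j = k then 1 else - a j) * x j s)" if "s \<in> S" for s
  proof -
    have "(\<Sum>j\<in>J. (if j = k then 1 else - a j) * x j s) = x k s + (\<Sum>j\<in>J - {k}. - a j * x j s)"
      using assms by (subst sum.remove[of J k]) auto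
    then show ?thesis
      using ols_resid_eq[OF assms(1) a that] by (simp add: e_def sum_negf)
  qed
  obtain c0 where c0: "orth_fit S J x y c0"
    using ex_orth_fit assms by blast
  have coef: "c k = (\<Sum>s\<in>S. e s * y s) / (\<Sum>s\<in>S. e s * x k s)" if "is_ols_fit S J x y c" for c
  proof -
    have "0 = (\<Sum>s\<in>S. (y s - (\<Sum>j\<in>J. c0 j * x j s)) * e s)"
      using orth_fit_span[OF c0, of "\<lambda>j. if j = k then 1 else - a j"] by (simp add: e_eq)
    \<comment> \<open>The fit \<open>c\<close> is only known to be a minimizer; it may replace
      \<open>c0\<close> because their fitted values coincide.\<close>
    also have "\<dots> = (\<Sum>s\<in>S. e s * y s) - (\<Sum>s\<in>S. e s * (\<Sum>j\<in>J. c j * x j s))"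
      using ols_fit_eq[OF assms(1) c0 that] by (simp add: algebra_simps sum_subtractf)
    also have "(\<Sum>s\<in>S. e s * (\<Sum>j\<in>J. c j * x j s)) = (\<Sum>j\<in>J. c j * (\<Sum>s\<in>S. e s * x j s))"
      by (simp add: sum_distrib_left mult_ac) (rule sum.swap)
    also have "\<dots> = c k * (\<Sum>s\<in>S. e s * x k s)"
      using assms e0 by (subst sum.remove[of J k]) auto
    finally show ?thesis
      using nz by (simp add: field_simps)
  qed
  show ?thesis
    unfolding ols_coef_def
    by (rule the_equality) (use coef orth_fit_is_ols_fit[OF c0] in metis)+
qed

subsection \<open>The residualized treatment\<close>

text \<open>Relabelling carries normal equations to normal equations: if \<open>c\<close> solves the
  original ones, then \<open>c \<circ> \<rho>\<close> solves the relabelled ones.\<close>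

lemma ols_resid_reindex:
  assumes "finite S" "finite J" "bij_betw \<sigma> S S" "bij_betw \<rho> J J"
    and x: "\<And>j s. j \<in> J \<Longrightarrow> s \<in> S \<Longrightarrow> x' j s = x (\<rho> j) (\<sigma> s)"
    and y: "\<And>s. s \<in> S \<Longrightarrow> y' s = y (\<sigma> s)"
    and "s \<in> S"
  shows "ols_resid S J x' y' s = ols_resid S J x y (\<sigma> s)"
proof -
  obtain c where c: "orth_fit S J x y c"
    using ex_orth_fit assms(1,2) by blast
  have fit: "(\<Sum>j\<in>J. c (\<rho> j) * x' j u) = (\<Sum>j\<in>J. c j * x j (\<sigma> u))" if "u \<in> S" for u
    unfolding sum.reindex_bij_betw[OF assms(4), symmetric, of "\<lambda>j. c j * x j (\<sigma> u)"]
    using that by (simp add: x)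
  have "orth_fit S J x' y' (c \<circ> \<rho>)"
    unfolding orth_fit_def
  proof
    fix i assume i: "i \<in> J"
    have "(\<Sum>u\<in>S. (y' u - (\<Sum>j\<in>J. (c \<circ> \<rho>) j * x' j u)) * x' i u)
        = (\<Sum>u\<in>S. (y (\<sigma> u) - (\<Sum>j\<in>J. c j * x j (\<sigma> u))) * x (\<rho> i) (\<sigma> u))"
      using i fit by (intro sum.cong) (simp_all add: x y)
    also have "\<dots> = (\<Sum>u\<in>S. (y u - (\<Sum>j\<in>J. c j * x j u)) * x (\<rho> i) u)"
      by (rule sum.reindex_bij_betw[OF assms(3)])
    also have "\<dots> = 0"
      using c bij_betwE[OF assms(4)] i by (simp add: orth_fit_def)
    finally show "(\<Sum>u\<in>S. (y' u - (\<Sum>j\<in>J. (c \<circ> \<rho>) j * x' j u)) * x' i u) = 0" .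
  qed
  from ols_resid_eq[OF assms(1) this \<open>s \<in> S\<close>] show ?thesis
    using ols_resid_eq[OF assms(1) c] bij_betwE[OF assms(3)] \<open>s \<in> S\<close> by (simp add: fit y)
qed

section \<open>Zero sums of the residualized treatment and sums of the weights\<close>

lemma finite_cells [simp]: "finite (cells G T K)"
  by (simp add: cells_def)

lemma finite_regressors [simp]: "finite (regressors G T K)"
  by (simp add: regressors_def)

lemma Lag_in_regressors [simp]: "Lag k \<in> regressors G T K \<longleftrightarrow> k \<le> K"
  by (auto simp: regressors_def)

lemma sum_cells: "(\<Sum>s\<in>cells G T K. f s) = (\<Sum>g=1..G. \<Sum>t=K+1..T. f (g, t))"
  by (simp add: cells_def sum.cartesian_product)

text \<open>Taking \<open>i\<close> to be a group dummy, a period dummy or another lag gives the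
  three zero sums that follow.\<close>

lemma eta_orth:
  assumes "i \<in> regressors G T K - {Lag k}"
  shows "(\<Sum>g=1..G. \<Sum>t=K+1..T. eta G T K p k g t * regressor_value p i (g, t)) = 0"
  using ols_resid_orth[of "cells G T K" "regressors G T K - {Lag k}" i "regressor_value p"
      "\<lambda>(g, t). p g (t - k)"] assms
  by (simp add: sum_cells eta_def)

lemma sum_eta_periods:
  assumes "g \<in> {1..G}"
  shows "(\<Sum>t=K+1..T. eta G T K p k g t) = 0"
proof -
  have "(\<Sum>g'=1..G. \<Sum>t=K+1..T. eta G T K p k g' t * of_bool (g' = g)) = 0"
    using eta_orth[of "GroupFE g" G T K k p] assms by (auto simp: regressors_def)
  moreover have "(\<Sum>g'=1..G. \<Sum>t=K+1..T. eta G T K p k g' t * of_bool (g' = g))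
      = (\<Sum>g'=1..G. if g' = g then \<Sum>t=K+1..T. eta G T K p k g' t else 0)"
    by (intro sum.cong) auto
  ultimately show ?thesis using assms by simp
qed

lemma sum_eta_groups:
  assumes "t \<in> {K+1..T}"
  shows "(\<Sum>g=1..G. eta G T K p k g t) = 0"
proof -
  have "(\<Sum>g=1..G. \<Sum>t'=K+1..T. eta G T K p k g t' * of_bool (t' = t)) = 0"
    using eta_orth[of "PeriodFE t" G T K k p] assms by (auto simp: regressors_def)
  moreover have "(\<Sum>t'=K+1..T. eta G T K p k g t' * of_bool (t' = t)) = eta G T K p k g t" for g
    using assms by (simp add: if_distrib cong: if_cong)
  ultimately show ?thesis by simp
qed

lemma sum_eta_lag:
  assumes "k' \<le> K" "k' \<noteq> k"
  shows "(\<Sum>g=1..G. \<Sum>t=K+1..T. eta G T K p k g t * p g (t - k')) = 0"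
  using eta_orth[of "Lag k'" G T K k p] assms by simp

lemma dl_twfe_eq:
  assumes "k \<le> K" "weight_denom G T K p k \<noteq> 0"
  shows "dl_twfe G T K p y k
    = (\<Sum>g=1..G. \<Sum>t=K+1..T. eta G T K p k g t * y g t) / (real G * weight_denom G T K p k)"
proof -
  have lag: "regressor_value p (Lag k) = (\<lambda>(g, t). p g (t - k))"
    by auto
  \<comment> \<open>A nonzero \<open>weight_denom\<close> forces \<open>G\<close> to be nonzero, so
    its factor \<open>1 / real G\<close> cancels.\<close>
  have den: "(\<Sum>s\<in>cells G T K. ols_resid (cells G T K) (regressors G T K - {Lag k})
      (regressor_value p) (regressor_value p (Lag k)) s * regressor_value p (Lag k) s)
      = real G * weight_denom G T K p k"
    unfolding lag using assms by (auto simp: sum_cells weight_denom_def simp flip: eta_def)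
  show ?thesis
    unfolding dl_twfe_def
    using frisch_waugh_lovell[of "cells G T K" "regressors G T K" "Lag k" "regressor_value p"] assms den
    by (auto simp: weight_denom_def sum_cells lag eta_def)
qed

lemma sum_weight_own:
  assumes "weight_denom G T K p k \<noteq> 0"
  shows "(\<Sum>g=1..G. weight G T K p k k g) = real G"
proof -
  have "(\<Sum>g=1..G. weight G T K p k k g)
      = (\<Sum>g=1..G. \<Sum>t=K+1..T. eta G T K p k g t * p g (t - k)) / weight_denom G T K p k"
    by (simp add: weight_def sum_divide_distrib)
  also have "\<dots> = real G"
    using assms unfolding weight_denom_def by (simp add: field_simps)
  finally show ?thesis .
qed

lemma sum_weight_other:
  assumes "k' \<le> K" "k' \<noteq> k"
  shows "(\<Sum>g=1..G. weight G T K p k k' g) = 0"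
  using sum_eta_lag[OF assms] by (simp add: weight_def flip: sum_divide_distrib)

text \<open>Permuting groups relabels the cells and the group dummies; period dummies and lags keep
  their names. Agreement of \<open>p'\<close> and \<open>p\<close> is asked on the panel only, so
  the identity permutation also allows an array to be exchanged for its restriction to the
  panel.\<close>

lemma eta_permute:
  assumes "\<pi> permutes {1..G}" "k \<le> K" "g \<in> {1..G}" "t \<in> {K+1..T}"
    and p: "\<And>g t. g \<in> {1..G} \<Longrightarrow> t \<in> {1..T} \<Longrightarrow> p' g t = p (\<pi> g) t"
  shows "eta G T K p' k g t = eta G T K p k (\<pi> g) t"
proof -
  define \<rho> where "\<rho> r = (case r of GroupFE g \<Rightarrow> GroupFE (\<pi> g) | _ \<Rightarrow> r)" for r
  let ?J = "regressors G T K - {Lag k}"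
  have inj: "inj \<pi>" and bij: "bij_betw \<pi> {1..G} {1..G}"
    using assms(1) by (simp_all add: permutes_inj permutes_imp_bij)
  have in_iff: "\<pi> g \<in> {1..G} \<longleftrightarrow> g \<in> {1..G}" for g
    using permutes_in_image[OF assms(1)] .
  have sig: "bij_betw (\<lambda>(g, t). (\<pi> g, t)) (cells G T K) (cells G T K)"
    unfolding cells_def using bij_betw_map_prod[OF bij bij_betw_id] by (simp add: map_prod_def)
  have "r = r'" if "\<rho> r = \<rho> r'" for r r'
    using that inj by (cases r; cases r') (simp_all add: \<rho>_def inj_eq)
  then have "inj_on \<rho> ?J" by (simp add: inj_on_def)
  moreover have "\<rho> r \<in> ?J" if "r \<in> ?J" for r
    using that in_iff by (cases r) (simp_all add: regressors_def \<rho>_def image_iff)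
  then have "\<rho> ` ?J \<subseteq> ?J" by (rule image_subsetI)
  ultimately have rho: "bij_betw \<rho> ?J ?J"
    by (simp add: bij_betw_def endo_inj_surj)
  \<comment> \<open>From \<open>t \<ge> K + 1\<close> and \<open>l \<le> K\<close>, the lagged
    period lies in \<open>{1..T}\<close> and the subtraction is not truncated.\<close>
  have p_lag: "p' g (t - l) = p (\<pi> g) (t - l)" if "l \<le> K" "(g, t) \<in> cells G T K" for g t l
    by (rule p) (use that in \<open>auto simp: cells_def\<close>)
  have "ols_resid (cells G T K) ?J (regressor_value p') (\<lambda>(g, t). p' g (t - k)) (g, t)
      = ols_resid (cells G T K) ?J (regressor_value p) (\<lambda>(g, t). p g (t - k))
        ((\<lambda>(g, t). (\<pi> g, t)) (g, t))"
  proof (rule ols_resid_reindex[OF _ _ sig rho])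
    show "regressor_value p' j s = regressor_value p (\<rho> j) ((\<lambda>(g, t). (\<pi> g, t)) s)"
      if "j \<in> ?J" "s \<in> cells G T K" for j s
      using that inj p_lag by (cases j; cases s) (simp_all add: \<rho>_def inj_eq)
    show "(\<lambda>(g, t). p' g (t - k)) s = (\<lambda>(g, t). p g (t - k)) ((\<lambda>(g, t). (\<pi> g, t)) s)"
      if "s \<in> cells G T K" for s
      using that assms(2) p_lag by (cases s) simp
  qed (use assms in \<open>auto simp: cells_def\<close>)
  then show ?thesis by (simp add: eta_def)
qed

lemma weight_denom_permute:
  assumes "\<pi> permutes {1..G}" "k \<le> K"
    and p: "\<And>g t. g \<in> {1..G} \<Longrightarrow> t \<in> {1..T} \<Longrightarrow> p' g t = p (\<pi> g) t"
  shows "weight_denom G T K p' k = weight_denom G T K p k"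
proof -
  have eta: "eta G T K p' k g t = eta G T K p k (\<pi> g) t" if "g \<in> {1..G}" "t \<in> {K+1..T}" for g t
    using assms(1,2) that p by (rule eta_permute)
  have p_lag: "p' g (t - k) = p (\<pi> g) (t - k)" if "g \<in> {1..G}" "t \<in> {K+1..T}" for g t
    by (rule p) (use assms(2) that in auto)
  have "(\<Sum>g=1..G. \<Sum>t=K+1..T. eta G T K p' k g t * p' g (t - k))
      = (\<Sum>g=1..G. \<Sum>t=K+1..T. eta G T K p k (\<pi> g) t * p (\<pi> g) (t - k))"
    using assms(2) by (intro sum.cong) (auto simp: eta p_lag)
  also have "\<dots> = (\<Sum>g=1..G. \<Sum>t=K+1..T. eta G T K p k g t * p g (t - k))"
    by (rule sum.reindex_bij_betw[OF permutes_imp_bij[OF assms(1)]])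
  finally show ?thesis by (simp add: weight_denom_def)
qed

lemma weight_permute:
  assumes "\<pi> permutes {1..G}" "k \<le> K" "k' \<le> K" "g \<in> {1..G}"
    and p: "\<And>g t. g \<in> {1..G} \<Longrightarrow> t \<in> {1..T} \<Longrightarrow> p' g t = p (\<pi> g) t"
  shows "weight G T K p' k k' g = weight G T K p k k' (\<pi> g)"
proof -
  have eta: "eta G T K p' k g t = eta G T K p k (\<pi> g) t" if "g \<in> {1..G}" "t \<in> {K+1..T}" for g t
    using assms(1,2) that p by (rule eta_permute)
  have p_lag: "p' g (t - k') = p (\<pi> g) (t - k')" if "g \<in> {1..G}" "t \<in> {K+1..T}" for g t
    by (rule p) (use assms(3) that in auto)
  have "(\<Sum>t=K+1..T. eta G T K p' k g t * p' g (t - k'))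
      = (\<Sum>t=K+1..T. eta G T K p k (\<pi> g) t * p (\<pi> g) (t - k'))"
    using assms(2-4) by (intro sum.cong) (auto simp: eta p_lag)
  then show ?thesis
    using weight_denom_permute[of \<pi> G k K T p' p] assms(1,2) p by (simp add: weight_def)
qed

section \<open>Measurability of residuals and weights in the treatment array\<close>

lemma eta_measurable:
  assumes "k \<le> K" "g \<in> {1..G}" "t \<in> {K+1..T}"
    and p: "\<And>g t. g \<in> {1..G} \<Longrightarrow> t \<in> {1..T} \<Longrightarrow> (\<lambda>z. p z g t) \<in> borel_measurable L"
  shows "(\<lambda>z. eta G T K (p z) k g t) \<in> borel_measurable L"
  unfolding eta_def
proof (rule ols_resid_measurable)
  have lag: "(\<lambda>z. p z g (t - k)) \<in> borel_measurable L" if "k \<le> K" "(g, t) \<in> cells G T K" for g t k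
    by (rule p) (use that in \<open>auto simp: cells_def\<close>)
  show "(\<lambda>z. regressor_value (p z) j s) \<in> borel_measurable L"
    if "j \<in> regressors G T K - {Lag k}" "s \<in> cells G T K" for j s
    using that lag by (cases j; cases s) simp_all
  show "(\<lambda>z. case s of (g, t) \<Rightarrow> p z g (t - k)) \<in> borel_measurable L" if "s \<in> cells G T K" for s
    using that assms(1) lag by (cases s) simp
qed (use assms in \<open>auto simp: cells_def\<close>)

lemma weight_denom_measurable:
  assumes "k \<le> K"
    and p: "\<And>g t. g \<in> {1..G} \<Longrightarrow> t \<in> {1..T} \<Longrightarrow> (\<lambda>z. p z g t) \<in> borel_measurable L"
  shows "(\<lambda>z. weight_denom G T K (p z) k) \<in> borel_measurable L"
proof -
  have [measurable]: "(\<lambda>z. eta G T K (p z) k g t) \<in> borel_measurable L" if "g \<in> {1..G}" "t \<in> {K+1..T}" for g t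
    by (rule eta_measurable) (use assms that in auto)
  have [measurable]: "(\<lambda>z. p z g (t - k)) \<in> borel_measurable L" if "g \<in> {1..G}" "t \<in> {K+1..T}" for g t
    by (rule p) (use assms(1-1) that in auto)
  show ?thesis unfolding weight_denom_def by measurable
qed

lemma weight_measurable:
  assumes "k \<le> K" "k' \<le> K" "g \<in> {1..G}"
    and p: "\<And>g t. g \<in> {1..G} \<Longrightarrow> t \<in> {1..T} \<Longrightarrow> (\<lambda>z. p z g t) \<in> borel_measurable L"
  shows "(\<lambda>z. weight G T K (p z) k k' g) \<in> borel_measurable L"
proof -
  have [measurable]: "(\<lambda>z. eta G T K (p z) k g t) \<in> borel_measurable L" if "t \<in> {K+1..T}" for t
    by (rule eta_measurable) (use assms that in auto)
  have [measurable]: "(\<lambda>z. p z g (t - k')) \<in> borel_measurable L" if "t \<in> {K+1..T}" for t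
    by (rule p) (use assms(1-3) that in auto)
  have [measurable]: "(\<lambda>z. weight_denom G T K (p z) k) \<in> borel_measurable L"
    using assms(1) p by (rule weight_denom_measurable)
  show ?thesis unfolding weight_def by measurable
qed

subsection \<open>Independent families and conditional means\<close>

text \<open>The joint law of an i.i.d. family is a power of the single law \<open>\<mu>\<close>,
  which a bijective relabelling of the coordinates preserves; both sides integrate \<open>F\<close>
  against it.\<close>

lemma (in prob_space) integral_iid_reindex:
  fixes F :: "('i \<Rightarrow> 'b) \<Rightarrow> real"
  assumes indep: "indep_vars (\<lambda>_. N) Z I" and "I \<noteq> {}"
    and distr: "\<And>i. i \<in> I \<Longrightarrow> distr M N (Z i) = \<mu>"
    and \<pi>: "bij_betw \<pi> I I" and F [measurable]: "F \<in> borel_measurable (\<Pi>\<^sub>M i\<in>I. N)"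
  shows "(\<integral>\<omega>. F (\<lambda>i\<in>I. Z (\<pi> i) \<omega>) \<partial>M) = (\<integral>\<omega>. F (\<lambda>i\<in>I. Z i \<omega>) \<partial>M)"
proof -
  let ?Z = "\<lambda>\<omega>. \<lambda>i\<in>I. Z i \<omega>" and ?r = "\<lambda>z. \<lambda>i\<in>I. z (\<pi> i)"
  have rv [measurable]: "Z i \<in> measurable M N" if "i \<in> I" for i
    using indep that by (simp add: indep_vars_def)
  have \<pi>I: "\<pi> i \<in> I" if "i \<in> I" for i
    using bij_betwE[OF \<pi>] that by blast
  obtain i0 where "i0 \<in> I" using \<open>I \<noteq> {}\<close> by blast
  then have prob: "prob_space \<mu>" and sets_\<mu> [measurable_cong]: "sets \<mu> = sets N"
    using distr[symmetric] by (auto intro: prob_space_distr)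
  have Z: "?Z \<in> measurable M (\<Pi>\<^sub>M i\<in>I. N)" by measurable
  have r: "?r \<in> measurable (\<Pi>\<^sub>M i\<in>I. N) (\<Pi>\<^sub>M i\<in>I. N)"
    using \<pi>I by (intro measurable_restrict) auto
  \<comment> \<open>\<open>N\<close> supplies the sigma-algebra and \<open>\<mu>\<close> the law, so
    measurability can be passed between the two products.\<close>
  have sets_PiM: "sets (\<Pi>\<^sub>M i\<in>I. \<mu>) = sets (\<Pi>\<^sub>M i\<in>I. N)"
    by (intro sets_PiM_cong refl sets_\<mu>)
  have law: "distr M (\<Pi>\<^sub>M i\<in>I. N) ?Z = (\<Pi>\<^sub>M i\<in>I. \<mu>)"
    using indep_vars_iff_distr_eq_PiM'[of I Z "\<lambda>_. N"] indep \<open>I \<noteq> {}\<close> rv distr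
    by (simp cong: PiM_cong)
  have "distr (\<Pi>\<^sub>M i\<in>I. \<mu>) (\<Pi>\<^sub>M i\<in>I. N) ?r = distr (\<Pi>\<^sub>M i\<in>I. \<mu>) (\<Pi>\<^sub>M i\<in>I. \<mu>) ?r"
    by (rule distr_cong) (simp_all add: sets_PiM)
  also have "\<dots> = (\<Pi>\<^sub>M i\<in>I. \<mu>)"
    using distr_PiM_reindex[of I "\<lambda>_. \<mu>" \<pi> I] prob \<pi> \<pi>I by (auto simp: bij_betw_def)
  finally have inv: "distr (\<Pi>\<^sub>M i\<in>I. \<mu>) (\<Pi>\<^sub>M i\<in>I. N) ?r = (\<Pi>\<^sub>M i\<in>I. \<mu>)" .
  have F\<mu>: "F \<in> borel_measurable (\<Pi>\<^sub>M i\<in>I. \<mu>)" by measurable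
  have r\<mu>: "?r \<in> measurable (\<Pi>\<^sub>M i\<in>I. \<mu>) (\<Pi>\<^sub>M i\<in>I. N)"
    using r by (simp cong: measurable_cong_sets add: sets_PiM)
  have "(\<integral>\<omega>. F (\<lambda>i\<in>I. Z (\<pi> i) \<omega>) \<partial>M) = (\<integral>\<omega>. F (?r (?Z \<omega>)) \<partial>M)"
    using \<pi>I by (intro Bochner_Integration.integral_cong arg_cong[where f = F]) auto
  also have "\<dots> = (\<integral>z. F (?r z) \<partial>distr M (\<Pi>\<^sub>M i\<in>I. N) ?Z)"
    using measurable_compose[OF r F] by (rule integral_distr[OF Z, symmetric])
  also have "\<dots> = (\<integral>z. F z \<partial>distr (\<Pi>\<^sub>M i\<in>I. \<mu>) (\<Pi>\<^sub>M i\<in>I. N) ?r)"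
    unfolding law using F r\<mu> by (intro integral_distr[symmetric])
  also have "\<dots> = (\<integral>z. F z \<partial>distr M (\<Pi>\<^sub>M i\<in>I. N) ?Z)"
    unfolding law inv ..
  also have "\<dots> = (\<integral>\<omega>. F (?Z \<omega>) \<partial>M)"
    using F Z by (intro integral_distr)
  finally show ?thesis .
qed

text \<open>If the conditional mean of \<open>u (Z g)\<close> given \<open>\<phi> (Z g)\<close> is the constant \<open>\<delta>\<close>, conditioning in addition
  on the other \<open>\<phi> (Z i)\<close> does not change it: integrate over the \<open>g\<close>-th coordinate first.\<close>

lemma (in prob_space) integral_mult_mean_independent:
  fixes h :: "('i \<Rightarrow> 'c) \<Rightarrow> real" and u :: "'b \<Rightarrow> real"
  assumes indep: "indep_vars (\<lambda>_. N) Z I" and "finite I" "g \<in> I"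
    and \<phi> [measurable]: "\<phi> \<in> measurable N L"
    and h [measurable]: "h \<in> borel_measurable (\<Pi>\<^sub>M i\<in>I. L)" and B: "\<And>p. \<bar>h p\<bar> \<le> B"
    and u [measurable]: "u \<in> borel_measurable N" and int: "integrable M (\<lambda>\<omega>. u (Z g \<omega>))"
    and mean: "\<And>f. f \<in> borel_measurable L \<Longrightarrow> (\<And>x. \<bar>f x\<bar> \<le> B) \<Longrightarrow>
      (\<integral>\<omega>. f (\<phi> (Z g \<omega>)) * u (Z g \<omega>) \<partial>M) = \<delta> * (\<integral>\<omega>. f (\<phi> (Z g \<omega>)) \<partial>M)"
  shows "(\<integral>\<omega>. h (\<lambda>i\<in>I. \<phi> (Z i \<omega>)) * u (Z g \<omega>) \<partial>M) = \<delta> * (\<integral>\<omega>. h (\<lambda>i\<in>I. \<phi> (Z i \<omega>)) \<partial>M)"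
proof -
  let ?Z = "\<lambda>\<omega>. \<lambda>i\<in>I. Z i \<omega>"
  define I' where "I' = I - {g}"
  have I': "finite I'" "g \<notin> I'" "insert g I' = I"
    using assms(2,3) by (auto simp: I'_def)
  have rv [measurable]: "Z i \<in> measurable M N" if "i \<in> I" for i
    using indep that by (simp add: indep_vars_def)
  have rvg [measurable]: "Z g \<in> measurable M N" using \<open>g \<in> I\<close> by (rule rv)
  \<comment> \<open>Outside \<open>I\<close> the family is filled up with the law of
    \<open>Z g\<close>, because \<open>product_sigma_finite\<close> requires a sigma-finite measure
    at every index.\<close>
  define \<nu> where "\<nu> i = distr M N (Z (if i \<in> I then i else g))" for i
  have prob_\<nu>: "prob_space (\<nu> i)" for i
    unfolding \<nu>_def using \<open>g \<in> I\<close> rv by (auto intro!: prob_space_distr)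
  have sets_\<nu> [measurable_cong]: "sets (\<nu> i) = sets N" for i
    by (simp add: \<nu>_def)
  interpret product_sigma_finite \<nu>
    unfolding product_sigma_finite_def using prob_\<nu> prob_space_imp_sigma_finite by blast
  have sets_PiM [measurable_cong]: "sets (\<Pi>\<^sub>M i\<in>J. \<nu> i) = sets (\<Pi>\<^sub>M i\<in>J. N)" for J
    by (intro sets_PiM_cong refl sets_\<nu>)
  have law: "distr M (\<Pi>\<^sub>M i\<in>I. N) ?Z = (\<Pi>\<^sub>M i\<in>I. \<nu> i)"
  proof -
    have "distr M (\<Pi>\<^sub>M i\<in>I. N) ?Z = (\<Pi>\<^sub>M i\<in>I. distr M N (Z i))"
      using indep_vars_iff_distr_eq_PiM'[of I Z "\<lambda>_. N"] indep \<open>g \<in> I\<close> rv by blast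
    also have "\<dots> = (\<Pi>\<^sub>M i\<in>I. \<nu> i)"
      by (intro PiM_cong) (simp_all add: \<nu>_def)
    finally show ?thesis .
  qed
  have Z [measurable]: "?Z \<in> measurable M (\<Pi>\<^sub>M i\<in>I. N)" by measurable
  define H where "H z = h (\<lambda>i\<in>I. \<phi> (z i))" for z
  have H [measurable]: "H \<in> borel_measurable (\<Pi>\<^sub>M i\<in>I. N)"
    unfolding H_def by measurable
  have HB: "\<bar>H z\<bar> \<le> B" for z by (simp add: H_def B)
  have ug [measurable]: "(\<lambda>z. u (z g)) \<in> borel_measurable (\<Pi>\<^sub>M i\<in>I. N)"
    using \<open>g \<in> I\<close> by measurable
  have int_Hu: "integrable M (\<lambda>\<omega>. H (?Z \<omega>) * u (Z g \<omega>))"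
  proof (rule Bochner_Integration.integrable_bound)
    show "integrable M (\<lambda>\<omega>. B * u (Z g \<omega>))" using int by simp
    have "\<bar>H (?Z \<omega>) * u (Z g \<omega>)\<bar> \<le> \<bar>B * u (Z g \<omega>)\<bar>" for \<omega>
      using HB[of "?Z \<omega>"] by (simp add: abs_mult mult_right_mono)
    then show "AE \<omega> in M. norm (H (?Z \<omega>) * u (Z g \<omega>)) \<le> norm (B * u (Z g \<omega>))"
      by simp
  qed measurable
  have int_H: "integrable M (\<lambda>\<omega>. H (?Z \<omega>))"
    using HB by (intro integrable_const_bound[where B = B]) auto
  have int_H\<nu>: "integrable (\<Pi>\<^sub>M i\<in>I. \<nu> i) H"
    unfolding law[symmetric] using int_H by (simp add: integrable_distr_eq)
  have int_Hu\<nu>: "integrable (\<Pi>\<^sub>M i\<in>I. \<nu> i) (\<lambda>z. H z * u (z g))"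
    unfolding law[symmetric] using int_Hu \<open>g \<in> I\<close> by (simp add: integrable_distr_eq)
  have inner: "(\<integral>y. H (x(g := y)) * u y \<partial>\<nu> g) = \<delta> * (\<integral>y. H (x(g := y)) \<partial>\<nu> g)"
    if "x \<in> space (\<Pi>\<^sub>M i\<in>I'. \<nu> i)" for x
  proof -
    \<comment> \<open>With the other coordinates frozen at \<open>x\<close>, the integrand depends
      on \<open>y\<close> only through \<open>f (\<phi> y)\<close>, and \<open>f\<close> inherits
      the bound \<open>B\<close>; hence \<open>mean\<close> applies.\<close>
    define p where "p = (\<lambda>i\<in>I'. \<phi> (x i))"
    define f where "f l = h (p(g := l))" for l
    have "x i \<in> space N" if "i \<in> I'" for i
      using that \<open>x \<in> space (\<Pi>\<^sub>M i\<in>I'. \<nu> i)\<close> sets_eq_imp_space_eq[OF sets_\<nu>]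
      by (auto simp: space_PiM)
    then have "p \<in> space (\<Pi>\<^sub>M i\<in>I'. L)"
      using measurable_space[OF \<phi>] by (auto simp: p_def space_PiM)
    then have "(\<lambda>l. p(g := l)) \<in> measurable L (\<Pi>\<^sub>M i\<in>I. L)"
      using measurable_component_update[of p I' "\<lambda>_. L" g] I' by simp
    then have f [measurable]: "f \<in> borel_measurable L"
      unfolding f_def using h by (rule measurable_compose)
    have "(\<lambda>i\<in>I. \<phi> ((x(g := y)) i)) = p(g := \<phi> y)" for y
      using I' by (auto simp: p_def fun_eq_iff)
    then have Hf: "H (x(g := y)) = f (\<phi> y)" for y
      by (simp add: H_def f_def)
    have "(\<lambda>y. f (\<phi> y)) \<in> borel_measurable N" "(\<lambda>y. f (\<phi> y) * u y) \<in> borel_measurable N"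
      by measurable
    moreover have "\<bar>f l\<bar> \<le> B" for l by (simp add: f_def B)
    ultimately show ?thesis
      unfolding Hf using mean[OF f] \<open>g \<in> I\<close> by (simp add: \<nu>_def integral_distr)
  qed
  have "(\<integral>\<omega>. H (?Z \<omega>) * u (Z g \<omega>) \<partial>M) = (\<integral>z. H z * u (z g) \<partial>(\<Pi>\<^sub>M i\<in>I. \<nu> i))"
    unfolding law[symmetric] using \<open>g \<in> I\<close> by (subst integral_distr) simp_all
  also have "\<dots> = (\<integral>x. (\<integral>y. H (x(g := y)) * u y \<partial>\<nu> g) \<partial>(\<Pi>\<^sub>M i\<in>I'. \<nu> i))"
    using product_integral_insert[OF I'(1,2), of "\<lambda>z. H z * u (z g)"] int_Hu\<nu> by (simp add: I'(3))
  also have "\<dots> = (\<integral>x. \<delta> * (\<integral>y. H (x(g := y)) \<partial>\<nu> g) \<partial>(\<Pi>\<^sub>M i\<in>I'. \<nu> i))"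
    by (intro Bochner_Integration.integral_cong refl inner)
  also have "\<dots> = \<delta> * (\<integral>z. H z \<partial>(\<Pi>\<^sub>M i\<in>I. \<nu> i))"
    using product_integral_insert[OF I'(1,2), of H] int_H\<nu> by (simp add: I'(3))
  also have "(\<integral>z. H z \<partial>(\<Pi>\<^sub>M i\<in>I. \<nu> i)) = (\<integral>\<omega>. H (?Z \<omega>) \<partial>M)"
    unfolding law[symmetric] by (subst integral_distr) simp_all
  finally show ?thesis
    by (simp add: H_def cong: restrict_cong)
qed

text \<open>The factor \<open>f (X \<omega>)\<close> is measurable for the sigma-algebra generated
  by \<open>X\<close>, so \<open>\<Delta>\<close> may be replaced by its conditional expectation,
  here constant. This turns parallel trends into the hypothesis \<open>mean\<close> of
  \<open>integral_mult_mean_independent\<close>.\<close>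

lemma (in prob_space) integral_mult_const_cond_exp:
  fixes f :: "'b \<Rightarrow> real"
  assumes X: "X \<in> measurable M L" and int: "integrable M \<Delta>"
    and const: "AE \<omega> in M. real_cond_exp M (vimage_algebra (space M) X L) \<Delta> \<omega> = \<delta>"
    and f: "f \<in> borel_measurable L" and B: "\<And>x. \<bar>f x\<bar> \<le> B"
  shows "(\<integral>\<omega>. f (X \<omega>) * \<Delta> \<omega> \<partial>M) = \<delta> * (\<integral>\<omega>. f (X \<omega>) \<partial>M)"
proof -
  let ?A = "vimage_algebra (space M) X L"
  have X_space: "X \<in> space M \<rightarrow> space L"
    using measurable_space[OF X] by blast
  have sub: "subalgebra M ?A"
    using measurable_sets[OF X] by (auto simp: subalgebra_def sets_vimage_algebra2[OF X_space])
  interpret finite_measure_subalgebra M ?A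
    by standard (rule sub)
  have fX: "(\<lambda>\<omega>. f (X \<omega>)) \<in> borel_measurable ?A"
    using measurable_vimage_algebra1[OF X_space] f by (rule measurable_compose)
  have [measurable]: "(\<lambda>\<omega>. f (X \<omega>)) \<in> borel_measurable M"
    using X f by (rule measurable_compose)
  have [measurable]: "\<Delta> \<in> borel_measurable M" using int by simp
  have "integrable M (\<lambda>\<omega>. f (X \<omega>) * \<Delta> \<omega>)"
  proof (rule Bochner_Integration.integrable_bound)
    show "integrable M (\<lambda>\<omega>. B * \<Delta> \<omega>)" using int by simp
    have "\<bar>f (X \<omega>) * \<Delta> \<omega>\<bar> \<le> \<bar>B * \<Delta> \<omega>\<bar>" for \<omega>
      using B[of "X \<omega>"] by (simp add: abs_mult mult_right_mono)
    then show "AE \<omega> in M. norm (f (X \<omega>) * \<Delta> \<omega>) \<le> norm (B * \<Delta> \<omega>)" by simp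
  qed measurable
  from real_cond_exp_intg(2)[OF this fX]
  have "(\<integral>\<omega>. f (X \<omega>) * \<Delta> \<omega> \<partial>M) = (\<integral>\<omega>. f (X \<omega>) * real_cond_exp M ?A \<Delta> \<omega> \<partial>M)"
    by simp
  also have "\<dots> = (\<integral>\<omega>. f (X \<omega>) * \<delta> \<partial>M)"
    using const by (intro integral_cong_AE) auto
  finally show ?thesis by (simp add: mult.commute)
qed

text \<open>The products \<open>H i * u i\<close> need not be integrable one by one, so linearity is only available on the
  events where all \<open>H i\<close> are bounded.\<close>

lemma (in prob_space) integral_sum_eq_0_by_truncation:
  fixes H u :: "'i \<Rightarrow> 'a \<Rightarrow> real"
  assumes "finite I"
    and [measurable]: "\<And>i. i \<in> I \<Longrightarrow> H i \<in> borel_measurable M"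
    and int: "integrable M (\<lambda>\<omega>. \<Sum>i\<in>I. H i \<omega> * u i \<omega>)"
    and zero: "\<And>n::nat. (\<integral>\<omega>. (\<Sum>i\<in>I. of_bool (\<forall>j\<in>I. \<bar>H j \<omega>\<bar> \<le> n) * H i \<omega> * u i \<omega>) \<partial>M) = 0"
  shows "(\<integral>\<omega>. (\<Sum>i\<in>I. H i \<omega> * u i \<omega>) \<partial>M) = 0"
proof -
  let ?R = "\<lambda>\<omega>. \<Sum>i\<in>I. H i \<omega> * u i \<omega>"
  let ?b = "\<lambda>(n::nat) \<omega>. of_bool (\<forall>j\<in>I. \<bar>H j \<omega>\<bar> \<le> n) :: real"
  have meas: "?R \<in> borel_measurable M" using int by simp
  have ev: "{\<omega> \<in> space M. \<forall>j\<in>I. \<bar>H j \<omega>\<bar> \<le> real n} \<in> sets M" for n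
    using \<open>finite I\<close> by measurable
  have b: "?b n \<in> borel_measurable M" for n
    using borel_measurable_indicator[OF ev[of n]]
    by (rule measurable_cong[THEN iffD1, rotated]) (auto simp: indicator_def)
  have "(\<lambda>n. \<integral>\<omega>. ?b n \<omega> * ?R \<omega> \<partial>M) \<longlonglongrightarrow> (\<integral>\<omega>. ?R \<omega> \<partial>M)"
  proof (rule integral_dominated_convergence[where w = "\<lambda>\<omega>. \<bar>?R \<omega>\<bar>"])
    show "AE \<omega> in M. (\<lambda>n. ?b n \<omega> * ?R \<omega>) \<longlonglongrightarrow> ?R \<omega>"
    proof (rule AE_I2)
      fix \<omega>
      \<comment> \<open>At a fixed \<open>\<omega>\<close> the truncation is inactive from some
        \<open>n\<close> on: a bound on the sum of all \<open>\<bar>H j \<omega>\<bar>\<close>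
        bounds each of them.\<close>
      obtain n0 :: nat where n0: "(\<Sum>j\<in>I. \<bar>H j \<omega>\<bar>) \<le> n0"
        using real_arch_simple by blast
      have "?b n \<omega> = 1" if "n \<ge> n0" for n
      proof -
        have "\<bar>H j \<omega>\<bar> \<le> n" if "j \<in> I" for j
          using member_le_sum[of j I "\<lambda>j. \<bar>H j \<omega>\<bar>"] that \<open>finite I\<close> n0 \<open>n \<ge> n0\<close> by simp
        then show ?thesis by simp
      qed
      then show "(\<lambda>n. ?b n \<omega> * ?R \<omega>) \<longlonglongrightarrow> ?R \<omega>"
        by (intro tendsto_eventually eventually_sequentiallyI[of n0]) simp
    qed
  qed (use int meas b in \<open>auto simp: abs_mult intro!: borel_measurable_times\<close>)
  moreover have "(\<integral>\<omega>. ?b n \<omega> * ?R \<omega> \<partial>M) = 0" for n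
    using zero[of n] by (simp add: sum_distrib_left mult.assoc)
  ultimately show ?thesis
    by (simp add: LIMSEQ_const_iff)
qed

subsection \<open>Panels with i.i.d. groups\<close>

text \<open>There are countably many boxes with rational centre and radius
  \<open>inverse (Suc n)\<close>, so almost surely the path lies in no such box of probability 0.
  Every box around the realized path contains one of them that also contains the path, and so has
  positive probability.\<close>

lemma (in prob_space) AE_treatment_path_in_support:
  assumes [measurable]: "\<And>t. t \<in> {1..T} \<Longrightarrow> X t \<in> borel_measurable M"
  shows "AE \<omega> in M. treatment_path T X \<omega> \<in> path_support M T X"
proof -
  define box where "box q e = {\<omega> \<in> space M. \<forall>t\<in>{1..T}. \<bar>X t \<omega> - q t\<bar> < e}" for q :: "nat \<Rightarrow> real" and e
  have box [measurable]: "box q e \<in> sets M" for q e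
    unfolding box_def by measurable
  let ?C = "({1..T} \<rightarrow>\<^sub>E \<rat>) \<times> (UNIV :: nat set)"
  have cnt: "countable ?C"
    by (intro countable_SIGMA countable_PiE) (auto simp: countable_rat)
  have ae: "AE \<omega> in M. \<omega> \<in> box (fst c) (inverse (Suc (snd c))) \<longrightarrow>
      prob (box (fst c) (inverse (Suc (snd c)))) > 0" for c :: "(nat \<Rightarrow> real) \<times> nat"
  proof (cases "prob (box (fst c) (inverse (Suc (snd c)))) = 0")
    case True
    then have "AE \<omega> in M. \<omega> \<notin> box (fst c) (inverse (Suc (snd c)))"
      using prob_eq_0[OF box] by simp
    then show ?thesis by eventually_elim simp
  qed (simp add: zero_less_measure_iff)
  have "AE \<omega> in M. \<forall>c\<in>?C. \<omega> \<in> box (fst c) (inverse (Suc (snd c))) \<longrightarrow>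
      prob (box (fst c) (inverse (Suc (snd c)))) > 0"
    unfolding AE_ball_countable[OF cnt] using ae by blast
  with AE_space show ?thesis
  proof eventually_elim
    case (elim \<omega>)
    have "prob (box (treatment_path T X \<omega>) e) > 0" if "e > 0" for e
    proof -
      \<comment> \<open>Half of \<open>e\<close> suffices: the realized path and any other point of
        the rational box are both within \<open>inverse (Suc n)\<close> of its centre.\<close>
      obtain n where n: "inverse (real (Suc n)) < e / 2"
        using reals_Archimedean[of "e / 2"] \<open>e > 0\<close> by auto
      have "\<exists>r\<in>\<rat>. X t \<omega> < r \<and> r < X t \<omega> + inverse (Suc n)" for t
        by (rule Rats_dense_in_real) simp
      then obtain r where r: "\<And>t. r t \<in> \<rat>" "\<And>t. X t \<omega> < r t" "\<And>t. r t < X t \<omega> + inverse (Suc n)"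
        by metis
      define q where "q = (\<lambda>t\<in>{1..T}. r t)"
      have q: "\<bar>X t \<omega> - q t\<bar> < inverse (Suc n)" if "t \<in> {1..T}" for t
        using r(2,3)[of t] that by (simp add: q_def)
      have "(q, n) \<in> ?C" using r(1) by (auto simp: q_def)
      moreover have "\<omega> \<in> box q (inverse (Suc n))"
        using elim(1) q by (simp add: box_def)
      ultimately have "0 < prob (box q (inverse (Suc n)))"
        using elim(2) by fastforce
      also have "\<dots> \<le> prob (box (treatment_path T X \<omega>) e)"
      proof (rule finite_measure_mono[OF _ box])
        show "box q (inverse (Suc n)) \<subseteq> box (treatment_path T X \<omega>) e"
        proof
          fix \<omega>' assume \<omega>': "\<omega>' \<in> box q (inverse (Suc n))"
          have "\<bar>X t \<omega>' - X t \<omega>\<bar> < e" if t: "t \<in> {1..T}" for t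
          proof -
            have "\<bar>X t \<omega>' - q t\<bar> < inverse (Suc n)" using \<omega>' t by (simp add: box_def)
            then show ?thesis using q[OF t] n by linarith
          qed
          then show "\<omega>' \<in> box (treatment_path T X \<omega>) e"
            using \<omega>' by (simp add: box_def treatment_path_def)
        qed
      qed
      finally show ?thesis .
    qed
    then show ?case
      unfolding path_support_def box_def by (auto simp: treatment_path_def)
  qed
qed

lemma cov_eq:
  assumes "prob_space M" "integrable M X" "integrable M Z" "integrable M (\<lambda>\<omega>. X \<omega> * Z \<omega>)"
  shows "cov M X Z = (\<integral>\<omega>. X \<omega> * Z \<omega> \<partial>M) - (\<integral>\<omega>. X \<omega> \<partial>M) * (\<integral>\<omega>. Z \<omega> \<partial>M)"
proof -
  interpret prob_space M by fact
  define a b where "a = (\<integral>\<omega>. X \<omega> \<partial>M)" and "b = (\<integral>\<omega>. Z \<omega> \<partial>M)"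
  have "cov M X Z = (\<integral>\<omega>. X \<omega> * Z \<omega> - X \<omega> * b - a * Z \<omega> + a * b \<partial>M)"
    unfolding cov_def a_def[symmetric] b_def[symmetric] by (simp add: algebra_simps)
  also have "\<dots> = (\<integral>\<omega>. X \<omega> * Z \<omega> \<partial>M) - a * b - a * b + a * b"
    using assms(2-4) unfolding a_def b_def by (simp add: prob_space)
  finally show ?thesis by (simp add: a_def b_def)
qed

text \<open>Only the sampling assumptions are fixed here; parallel trends and the outcome model
  appear as premises of the lemmas that use them.\<close>

locale iid_panel = prob_space M for M :: "'w measure" +
  fixes G T K :: nat
    and D :: "nat \<Rightarrow> nat \<Rightarrow> 'w \<Rightarrow> real"
    and Y :: "nat \<Rightarrow> nat \<Rightarrow> (nat \<Rightarrow> real) \<Rightarrow> 'w \<Rightarrow> real"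
    and \<beta> :: "nat \<Rightarrow> nat \<Rightarrow> 'w \<Rightarrow> real"
  assumes KT: "K + 1 < T" and G: "1 \<le> G"
    and iid: "iid_groups M T K D Y \<beta>"
begin

abbreviation "P \<equiv> admissible_paths M T D"
abbreviation "N \<equiv> group_space T K P"
abbreviation "Z \<equiv> group_variable T K P D Y \<beta>"
abbreviation "L \<equiv> \<Pi>\<^sub>M t\<in>{1..T}. borel :: real measure"
abbreviation "paths \<omega> \<equiv> \<lambda>g\<in>{1..G}. treatment_path T (D g) \<omega>"

section \<open>Coordinates and common law of the group variables\<close>

lemma indep_Z: "indep_vars (\<lambda>_. N) Z {1..G}"
  using iid indep_vars_subset[of "\<lambda>_. N" Z "{1..}" "{1..G}"]
  by (auto simp: iid_groups_def Let_def)

lemma distr_Z: "g \<ge> 1 \<Longrightarrow> distr M N (Z g) = distr M N (Z 1)"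
  using iid unfolding iid_groups_def Let_def by blast

lemma Z_measurable: "g \<ge> 1 \<Longrightarrow> Z g \<in> measurable M N"
  using iid by (auto simp: iid_groups_def Let_def indep_vars_def)

lemma path_measurable: "(\<lambda>z. fst (snd z)) \<in> measurable N L"
  unfolding group_space_def by measurable

lemma path_component_measurable: "t \<in> {1..T} \<Longrightarrow> (\<lambda>z. fst (snd z) t) \<in> borel_measurable N"
  using path_measurable by (rule measurable_compose) simp

text \<open>\<open>admissible_paths\<close> contains the zero path by construction, so the
  never-treated outcome is a coordinate of \<open>N\<close> even when that path lies outside the
  support.\<close>

lemma outcome_measurable: "t \<in> {1..T} \<Longrightarrow> (\<lambda>z. fst z (t, zero_path T)) \<in> borel_measurable N"
  unfolding group_space_def
  by (rule measurable_compose[OF measurable_fst]) (simp add: admissible_paths_def)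

lemma coef_measurable: "k \<le> K \<Longrightarrow> (\<lambda>z. snd (snd z) k) \<in> borel_measurable N"
  unfolding group_space_def
  by (rule measurable_compose[OF measurable_snd], rule measurable_compose[OF measurable_snd]) simp

lemma path_Z: "fst (snd (Z g \<omega>)) = treatment_path T (D g) \<omega>"
  by (simp add: group_variable_def)

lemma path_component_Z: "t \<in> {1..T} \<Longrightarrow> fst (snd (Z g \<omega>)) t = D g t \<omega>"
  by (simp add: group_variable_def treatment_path_def)

lemma outcome_Z: "t \<in> {1..T} \<Longrightarrow> fst (Z g \<omega>) (t, zero_path T) = Y g t (zero_path T) \<omega>"
  by (simp add: group_variable_def admissible_paths_def)

lemma coef_Z: "k \<le> K \<Longrightarrow> snd (snd (Z g \<omega>)) k = \<beta> g k \<omega>"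
  by (simp add: group_variable_def)

lemma D_measurable: "g \<ge> 1 \<Longrightarrow> t \<in> {1..T} \<Longrightarrow> D g t \<in> borel_measurable M"
  using measurable_compose[OF Z_measurable path_component_measurable] by (simp add: path_component_Z)

lemma treatment_path_measurable: "g \<ge> 1 \<Longrightarrow> treatment_path T (D g) \<in> measurable M L"
  using measurable_compose[OF Z_measurable path_measurable] by (simp add: path_Z)

lemma integral_same_law:
  fixes f :: "_ \<Rightarrow> real"
  assumes "f \<in> borel_measurable N" "g \<ge> 1"
  shows "(\<integral>\<omega>. f (Z g \<omega>) \<partial>M) = (\<integral>\<omega>. f (Z 1 \<omega>) \<partial>M)"
  using integral_distr[OF Z_measurable assms(1), of g] integral_distr[OF Z_measurable assms(1), of 1]
    distr_Z[of g] assms(2) by simp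

text \<open>The support is determined by box probabilities, hence by the common law of the group
  variables. This is needed because \<open>admissible_paths\<close> is formed from group 1
  alone.\<close>

lemma path_support_same:
  assumes "g \<ge> 1"
  shows "path_support M T (D g) = path_support M T (D 1)"
proof -
  have "prob {\<omega> \<in> space M. \<forall>t\<in>{1..T}. \<bar>D g t \<omega> - d t\<bar> < e}
      = measure (distr M N (Z g)) {z \<in> space N. \<forall>t\<in>{1..T}. \<bar>fst (snd z) t - d t\<bar> < e}"
    if "g \<ge> 1" for g d e
  proof -
    have [measurable]: "\<And>t. t \<in> {1..T} \<Longrightarrow> (\<lambda>z. fst (snd z) t) \<in> borel_measurable N"
      by (rule path_component_measurable)
    have "{z \<in> space N. \<forall>t\<in>{1..T}. \<bar>fst (snd z) t - d t\<bar> < e} \<in> sets N"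
      by measurable
    then show ?thesis
      using measurable_space[OF Z_measurable[OF that]]
      by (subst measure_distr[OF Z_measurable[OF that]])
        (auto simp: path_component_Z intro!: arg_cong[where f = prob])
  qed
  then show ?thesis
    using distr_Z[OF assms] assms by (simp add: path_support_def)
qed

lemma AE_path_admissible:
  assumes "g \<ge> 1"
  shows "AE \<omega> in M. treatment_path T (D g) \<omega> \<in> P"
proof -
  have "AE \<omega> in M. treatment_path T (D g) \<omega> \<in> path_support M T (D g)"
    using assms by (intro AE_treatment_path_in_support D_measurable)
  then show ?thesis
    by eventually_elim (use path_support_same[OF assms] in \<open>simp add: admissible_paths_def\<close>)
qed

text \<open>Outside one null event the model equation holds for all admissible paths at once, so it
  can be evaluated at the random realized path, which is almost surely admissible.\<close>

lemma AE_observed_outcome: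
  assumes "random_coef_dl_model M T K D Y \<beta>" "g \<ge> 1"
  shows "AE \<omega> in M. \<forall>t\<in>{K+1..T}. observed_outcome T D Y g t \<omega>
    = Y g t (zero_path T) \<omega> + (\<Sum>k=0..K. \<beta> g k \<omega> * D g (t - k) \<omega>)"
proof -
  have "AE \<omega> in M. \<forall>t\<in>{1..T}. \<forall>d\<in>P.
      Y g t d \<omega> = Y g t (zero_path T) \<omega> + (\<Sum>k=0..min K (t - 1). \<beta> g k \<omega> * d (t - k))"
    using assms by (simp add: random_coef_dl_model_def)
  with AE_path_admissible[OF assms(2)] show ?thesis
  proof eventually_elim
    case (elim \<omega>)
    show ?case
    proof
      fix t assume t: "t \<in> {K+1..T}"
      \<comment> \<open>From period \<open>K + 1\<close> on, all \<open>K\<close> lags are inside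
        the panel.\<close>
      then have "min K (t - 1) = K" by auto
      then have "observed_outcome T D Y g t \<omega>
          = Y g t (zero_path T) \<omega> + (\<Sum>k=0..K. \<beta> g k \<omega> * treatment_path T (D g) \<omega> (t - k))"
        using elim t by (auto simp: observed_outcome_def)
      also have "(\<Sum>k=0..K. \<beta> g k \<omega> * treatment_path T (D g) \<omega> (t - k))
          = (\<Sum>k=0..K. \<beta> g k \<omega> * D g (t - k) \<omega>)"
        using t by (intro sum.cong) (auto simp: treatment_path_def)
      finally show "observed_outcome T D Y g t \<omega>
          = Y g t (zero_path T) \<omega> + (\<Sum>k=0..K. \<beta> g k \<omega> * D g (t - k) \<omega>)" .
    qed
  qed
qed

section \<open>Exchangeability of the weights\<close>

lemma W_Z:
  assumes "k \<le> K" "k' \<le> K" "g \<in> {1..G}" "\<pi> permutes {1..G}"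
  shows "weight G T K (\<lambda>i. fst (snd (Z (\<pi> i) \<omega>))) k k' g = W G T K D k k' (\<pi> g) \<omega>"
  unfolding W_def using assms by (intro weight_permute) (auto simp: path_component_Z)

text \<open>A group's weight involves the paths of all groups, so equal marginal laws do not
  suffice: the joint law is used, with groups \<open>1\<close> and \<open>g\<close> swapped. The
  function \<open>c\<close> will be the constant 1 or a coefficient.\<close>

lemma W_exchangeable:
  fixes c :: "_ \<Rightarrow> real"
  assumes "k \<le> K" "k' \<le> K" "g \<in> {1..G}" and c [measurable]: "c \<in> borel_measurable N"
  shows "(\<integral>\<omega>. W G T K D k k' g \<omega> * c (Z g \<omega>) \<partial>M) = (\<integral>\<omega>. W G T K D k k' 1 \<omega> * c (Z 1 \<omega>) \<partial>M)"
proof -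
  let ?\<pi> = "Transposition.transpose 1 g"
  have \<pi>: "?\<pi> permutes {1..G}"
    using assms(3) G by (intro permutes_swap_id) auto
  have 1: "1 \<in> {1..G}" using G by simp
  define F where "F z = weight G T K (\<lambda>i. fst (snd (z i))) k k' 1 * c (z 1)"
    for z :: "nat \<Rightarrow> (nat \<times> (nat \<Rightarrow> real) \<Rightarrow> real) \<times> (nat \<Rightarrow> real) \<times> (nat \<Rightarrow> real)"
  have F: "F \<in> borel_measurable (\<Pi>\<^sub>M i\<in>{1..G}. N)"
    unfolding F_def
  proof (intro borel_measurable_times weight_measurable)
    show "(\<lambda>z. fst (snd (z i)) t) \<in> borel_measurable (\<Pi>\<^sub>M i\<in>{1..G}. N)"
      if "i \<in> {1..G}" "t \<in> {1..T}" for i t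
      using that path_component_measurable by (intro measurable_compose[OF measurable_component_singleton])
    show "(\<lambda>z. c (z 1)) \<in> borel_measurable (\<Pi>\<^sub>M i\<in>{1..G}. N)"
      using 1 c by (intro measurable_compose[OF measurable_component_singleton])
  qed (use assms 1 in auto)
  have F_eq: "F (\<lambda>i\<in>{1..G}. Z (\<sigma> i) \<omega>) = W G T K D k k' (\<sigma> 1) \<omega> * c (Z (\<sigma> 1) \<omega>)"
    if "\<sigma> permutes {1..G}" for \<sigma> \<omega>
  proof -
    \<comment> \<open>The restriction to \<open>{1..G}\<close> disappears by the permutation lemma
      at the identity, as weights read only cells of the panel.\<close>
    have "weight G T K (\<lambda>i. fst (snd ((\<lambda>i\<in>{1..G}. Z (\<sigma> i) \<omega>) i))) k k' 1
        = weight G T K (\<lambda>i. fst (snd (Z (\<sigma> i) \<omega>))) k k' (id 1)"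
      by (rule weight_permute[OF permutes_id]) (use assms 1 in auto)
    then show ?thesis
      using W_Z[OF assms(1,2) 1 that] 1 by (simp add: F_def)
  qed
  have "distr M N (Z i) = distr M N (Z 1)" if "i \<in> {1..G}" for i
    using that by (intro distr_Z) simp
  from integral_iid_reindex[OF indep_Z _ this permutes_imp_bij[OF \<pi>] F] 1
  have "(\<integral>\<omega>. F (\<lambda>i\<in>{1..G}. Z (?\<pi> i) \<omega>) \<partial>M) = (\<integral>\<omega>. F (\<lambda>i\<in>{1..G}. Z (id i) \<omega>) \<partial>M)"
    unfolding id_apply by blast
  then show ?thesis
    unfolding F_eq[OF \<pi>] F_eq[OF permutes_id] by simp
qed

text \<open>Parallel trends fix the mean of an increment given the group's own path; independence
  extends this to all paths, and the increments telescope from period 1 to \<open>t\<close>. The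
  level at period 1 may depend on the paths, so its term stays.\<close>

lemma integral_bounded_paths_outcome:
  fixes h :: "(nat \<Rightarrow> nat \<Rightarrow> real) \<Rightarrow> real"
  assumes pt: "parallel_trends M T D Y"
    and int: "\<And>g t. g \<ge> 1 \<Longrightarrow> t \<in> {1..T} \<Longrightarrow> integrable M (Y g t (zero_path T))"
    and h: "h \<in> borel_measurable (\<Pi>\<^sub>M g\<in>{1..G}. L)" and B: "\<And>p. \<bar>h p\<bar> \<le> B"
    and g: "g \<in> {1..G}" and "t \<in> {1..T}"
  shows "integrable M (\<lambda>\<omega>. h (paths \<omega>) * Y g t (zero_path T) \<omega>)"
    and "(\<integral>\<omega>. h (paths \<omega>) * Y g t (zero_path T) \<omega> \<partial>M)
      = (\<integral>\<omega>. h (paths \<omega>) * Y g 1 (zero_path T) \<omega> \<partial>M)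
        + ((\<integral>\<omega>. Y 1 t (zero_path T) \<omega> \<partial>M) - (\<integral>\<omega>. Y 1 1 (zero_path T) \<omega> \<partial>M))
          * (\<integral>\<omega>. h (paths \<omega>) \<partial>M)"
proof -
  have paths [measurable]: "paths \<in> measurable M (\<Pi>\<^sub>M g\<in>{1..G}. L)"
    by (intro measurable_restrict treatment_path_measurable) simp
  have h_paths: "(\<lambda>\<omega>. h (paths \<omega>)) \<in> borel_measurable M"
    using paths h by (rule measurable_compose)
  have int_h: "integrable M (\<lambda>\<omega>. h (paths \<omega>) * Y g t (zero_path T) \<omega>)" if t: "t \<in> {1..T}" for t
  proof (rule Bochner_Integration.integrable_bound)
    show "integrable M (\<lambda>\<omega>. B * Y g t (zero_path T) \<omega>)" using int g t by simp
    have "\<bar>h (paths \<omega>) * Y g t (zero_path T) \<omega>\<bar> \<le> \<bar>B * Y g t (zero_path T) \<omega>\<bar>" for \<omega>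
      using B[of "paths \<omega>"] by (simp add: abs_mult mult_right_mono)
    then show "AE \<omega> in M. norm (h (paths \<omega>) * Y g t (zero_path T) \<omega>)
        \<le> norm (B * Y g t (zero_path T) \<omega>)"
      by simp
    show "(\<lambda>\<omega>. h (paths \<omega>) * Y g t (zero_path T) \<omega>) \<in> borel_measurable M"
      using int[of g t] g t by (intro borel_measurable_times h_paths) auto
  qed
  show "integrable M (\<lambda>\<omega>. h (paths \<omega>) * Y g t (zero_path T) \<omega>)"
    using int_h \<open>t \<in> {1..T}\<close> by blast
  \<comment> \<open>Expressing means through group 1 makes the increments free of \<open>g\<close>,
    as the later sum over groups requires.\<close>
  have mean: "(\<integral>\<omega>. Y g t (zero_path T) \<omega> \<partial>M) = (\<integral>\<omega>. Y 1 t (zero_path T) \<omega> \<partial>M)" if "t \<in> {1..T}" for t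
    using integral_same_law[OF outcome_measurable[OF that], of g] g that by (simp add: outcome_Z)
  have increment: "(\<integral>\<omega>. h (paths \<omega>) * Y g (Suc t) (zero_path T) \<omega> \<partial>M)
      = (\<integral>\<omega>. h (paths \<omega>) * Y g t (zero_path T) \<omega> \<partial>M)
        + ((\<integral>\<omega>. Y 1 (Suc t) (zero_path T) \<omega> \<partial>M) - (\<integral>\<omega>. Y 1 t (zero_path T) \<omega> \<partial>M))
          * (\<integral>\<omega>. h (paths \<omega>) \<partial>M)"
    if t: "1 \<le> t" "Suc t \<le> T" for t
  proof -
    define u where "u z = fst z (Suc t, zero_path T) - fst z (t, zero_path T)"
      for z :: "(nat \<times> (nat \<Rightarrow> real) \<Rightarrow> real) \<times> (nat \<Rightarrow> real) \<times> (nat \<Rightarrow> real)"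
    have u: "u \<in> borel_measurable N"
      unfolding u_def using t by (intro borel_measurable_diff outcome_measurable) auto
    have uZ: "u (Z g \<omega>) = Y g (Suc t) (zero_path T) \<omega> - Y g t (zero_path T) \<omega>" for \<omega>
      using t by (simp add: u_def outcome_Z)
    have int_u: "integrable M (\<lambda>\<omega>. u (Z g \<omega>))"
      unfolding uZ using int g t by simp
    define \<delta> where "\<delta> = (\<integral>\<omega>. u (Z g \<omega>) \<partial>M)"
    have "AE \<omega> in M. real_cond_exp M (vimage_algebra (space M) (treatment_path T (D g)) L)
        (\<lambda>\<omega>. u (Z g \<omega>)) \<omega> = \<delta>"
      using pt[unfolded parallel_trends_def Let_def, rule_format, of g "Suc t"] g t
      by (simp add: uZ \<delta>_def)
    from integral_mult_const_cond_exp[OF treatment_path_measurable int_u this] g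
    have "(\<integral>\<omega>. h (\<lambda>i\<in>{1..G}. fst (snd (Z i \<omega>))) * u (Z g \<omega>) \<partial>M)
        = \<delta> * (\<integral>\<omega>. h (\<lambda>i\<in>{1..G}. fst (snd (Z i \<omega>))) \<partial>M)"
      by (intro integral_mult_mean_independent[OF indep_Z _ g path_measurable h B u int_u])
        (auto simp: path_Z)
    then have "(\<integral>\<omega>. h (paths \<omega>) * u (Z g \<omega>) \<partial>M) = \<delta> * (\<integral>\<omega>. h (paths \<omega>) \<partial>M)"
      by (simp add: path_Z)
    moreover have "(\<integral>\<omega>. h (paths \<omega>) * u (Z g \<omega>) \<partial>M)
        = (\<integral>\<omega>. h (paths \<omega>) * Y g (Suc t) (zero_path T) \<omega> \<partial>M)
          - (\<integral>\<omega>. h (paths \<omega>) * Y g t (zero_path T) \<omega> \<partial>M)"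
      unfolding uZ right_diff_distrib using int_h t by simp
    moreover have "\<delta> = (\<integral>\<omega>. Y 1 (Suc t) (zero_path T) \<omega> \<partial>M) - (\<integral>\<omega>. Y 1 t (zero_path T) \<omega> \<partial>M)"
      using int[of g "Suc t"] int[of g t] mean[of "Suc t"] mean[of t] g t by (simp add: \<delta>_def uZ)
    ultimately show ?thesis by simp
  qed
  have "1 \<le> t" "t \<le> T" using \<open>t \<in> {1..T}\<close> by auto
  then show "(\<integral>\<omega>. h (paths \<omega>) * Y g t (zero_path T) \<omega> \<partial>M)
      = (\<integral>\<omega>. h (paths \<omega>) * Y g 1 (zero_path T) \<omega> \<partial>M)
        + ((\<integral>\<omega>. Y 1 t (zero_path T) \<omega> \<partial>M) - (\<integral>\<omega>. Y 1 1 (zero_path T) \<omega> \<partial>M))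
          * (\<integral>\<omega>. h (paths \<omega>) \<partial>M)"
  proof (induction t rule: dec_induct)
    case (step t)
    then show ?case using increment[of t] unfolding left_diff_distrib by linarith
  qed simp
qed

text \<open>After truncation each outcome splits into its period-1 level, free of \<open>t\<close>,
  and a constant \<open>m t\<close>, free of \<open>g\<close>. The first part vanishes on summing
  the weights over periods, the second on summing them over groups.\<close>

lemma integral_never_treated_part:
  assumes pt: "parallel_trends M T D Y"
    and int_Y: "\<And>g t. g \<ge> 1 \<Longrightarrow> t \<in> {1..T} \<Longrightarrow> integrable M (Y g t (zero_path T))"
    and k: "k \<le> K"
  defines "H \<equiv> \<lambda>s \<omega>. eta G T K (\<lambda>g t. D g t \<omega>) k (fst s) (snd s)
      / (real G * weight_denom G T K (\<lambda>g t. D g t \<omega>) k)"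
  assumes int: "integrable M (\<lambda>\<omega>. \<Sum>s\<in>cells G T K. H s \<omega> * Y (fst s) (snd s) (zero_path T) \<omega>)"
  shows "(\<integral>\<omega>. (\<Sum>s\<in>cells G T K. H s \<omega> * Y (fst s) (snd s) (zero_path T) \<omega>) \<partial>M) = 0"
proof (rule integral_sum_eq_0_by_truncation[OF finite_cells _ int])
  let ?PL = "\<Pi>\<^sub>M g\<in>{1..G}. L"
  \<comment> \<open>The weights are rewritten as functions of the array of paths alone, the form
    needed for \<open>h\<close> in \<open>integral_bounded_paths_outcome\<close>.\<close>
  define Hp where "Hp p s = eta G T K p k (fst s) (snd s) / (real G * weight_denom G T K p k)" for p s
  have D_paths: "D g t \<omega> = paths \<omega> (id g) t" if "g \<in> {1..G}" "t \<in> {1..T}" for g t \<omega>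
    using that by (simp add: treatment_path_def)
  have H_paths: "H s \<omega> = Hp (paths \<omega>) s" if "s \<in> cells G T K" for s \<omega>
  proof -
    have "fst s \<in> {1..G}" "snd s \<in> {K+1..T}" using that by (auto simp: cells_def)
    from eta_permute[OF permutes_id k this, of "\<lambda>g t. D g t \<omega>" "paths \<omega>"]
      weight_denom_permute[OF permutes_id k, of G T "\<lambda>g t. D g t \<omega>" "paths \<omega>"] D_paths[of _ _ \<omega>]
    show ?thesis unfolding H_def Hp_def id_apply by metis
  qed
  have component: "(\<lambda>p. p g t) \<in> borel_measurable ?PL" if "g \<in> {1..G}" "t \<in> {1..T}" for g t
    using that by (intro measurable_compose[OF measurable_component_singleton[OF that(1)]
        measurable_component_singleton[OF that(2)]])
  have Hp: "(\<lambda>p. Hp p s) \<in> borel_measurable ?PL" if "s \<in> cells G T K" for s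
    unfolding Hp_def
    by (intro borel_measurable_divide borel_measurable_times borel_measurable_const
        eta_measurable weight_denom_measurable component)
      (use k that in \<open>auto simp: cells_def\<close>)
  have paths: "paths \<in> measurable M ?PL"
    by (intro measurable_restrict treatment_path_measurable) simp
  show "H s \<in> borel_measurable M" if "s \<in> cells G T K" for s
  proof -
    have "H s = (\<lambda>\<omega>. Hp (paths \<omega>) s)" by (rule ext) (rule H_paths[OF that])
    then show ?thesis using measurable_compose[OF paths Hp[OF that]] by simp
  qed
  fix n :: nat
  \<comment> \<open>The truncating event concerns all cells together. Its indicator is a common
    factor of every cell's weight, so the zero sums survive.\<close>
  define q where "q s p = of_bool (\<forall>j\<in>cells G T K. \<bar>Hp p j\<bar> \<le> n) * Hp p s" for s p
  have q_meas: "q s \<in> borel_measurable ?PL" if "s \<in> cells G T K" for s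
  proof -
    have "{p \<in> space ?PL. \<forall>j\<in>cells G T K. \<bar>Hp p j\<bar> \<le> n} \<in> sets ?PL"
      using Hp by measurable
    from borel_measurable_indicator[OF this]
    have "(\<lambda>p. of_bool (\<forall>j\<in>cells G T K. \<bar>Hp p j\<bar> \<le> n) :: real) \<in> borel_measurable ?PL"
      by (rule measurable_cong[THEN iffD1, rotated]) (auto simp: indicator_def)
    then show ?thesis
      unfolding q_def using Hp[OF that] by (rule borel_measurable_times)
  qed
  have q_bound: "\<bar>q s p\<bar> \<le> n" if "s \<in> cells G T K" for s p
    using that by (auto simp: q_def)
  \<comment> \<open>This and the next sum vanish for every \<open>p\<close>: where the denominator
    is 0, division gives 0.\<close>
  have Hp_periods: "(\<Sum>t=K+1..T. Hp p (g, t)) = 0" if "g \<in> {1..G}" for p g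
    using sum_eta_periods[OF that] by (simp add: Hp_def flip: sum_divide_distrib)
  have Hp_groups: "(\<Sum>g=1..G. Hp p (g, t)) = 0" if "t \<in> {K+1..T}" for p t
    using sum_eta_groups[OF that] by (simp add: Hp_def flip: sum_divide_distrib)
  have q_periods: "(\<Sum>t=K+1..T. q (g, t) p) = 0" if "g \<in> {1..G}" for p g
    using Hp_periods[OF that] unfolding q_def sum_distrib_left[symmetric] by simp
  have q_groups: "(\<Sum>g=1..G. q (g, t) p) = 0" if "t \<in> {K+1..T}" for p t
    using Hp_groups[OF that] unfolding q_def sum_distrib_left[symmetric] by simp
  have cell: "(g, t) \<in> cells G T K" "t \<in> {1..T}" if "g \<in> {1..G}" "t \<in> {K+1..T}" for g t
    using that by (auto simp: cells_def)
  define m where "m t = (\<integral>\<omega>. Y 1 t (zero_path T) \<omega> \<partial>M) - (\<integral>\<omega>. Y 1 1 (zero_path T) \<omega> \<partial>M)" for t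
  \<comment> \<open>The weight's period and the outcome's period are kept apart because the mean
    formula pairs the weight of period \<open>t\<close> with the outcome of period 1.\<close>
  have int_qY: "integrable M (\<lambda>\<omega>. q (g, t) (paths \<omega>) * Y g t' (zero_path T) \<omega>)"
    if "g \<in> {1..G}" "t \<in> {K+1..T}" "t' \<in> {1..T}" for g t t'
    by (rule integral_bounded_paths_outcome(1)[OF pt int_Y q_meas q_bound])
      (use that cell in auto)
  have int_q: "integrable M (\<lambda>\<omega>. q (g, t) (paths \<omega>))" if "g \<in> {1..G}" "t \<in> {K+1..T}" for g t
    using measurable_compose[OF paths q_meas[OF cell(1)[OF that]]] q_bound[OF cell(1)[OF that]]
    by (intro integrable_const_bound[where B = n]) auto
  have mean_qY: "(\<integral>\<omega>. q (g, t) (paths \<omega>) * Y g t (zero_path T) \<omega> \<partial>M)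
      = (\<integral>\<omega>. q (g, t) (paths \<omega>) * Y g 1 (zero_path T) \<omega> \<partial>M) + m t * (\<integral>\<omega>. q (g, t) (paths \<omega>) \<partial>M)"
    if "g \<in> {1..G}" "t \<in> {K+1..T}" for g t
    unfolding m_def
    by (rule integral_bounded_paths_outcome(2)[OF pt int_Y q_meas q_bound])
      (use that cell in auto)
  have part1: "(\<Sum>t=K+1..T. \<integral>\<omega>. q (g, t) (paths \<omega>) * Y g 1 (zero_path T) \<omega> \<partial>M) = 0"
    if "g \<in> {1..G}" for g
  proof -
    have "(\<Sum>t=K+1..T. \<integral>\<omega>. q (g, t) (paths \<omega>) * Y g 1 (zero_path T) \<omega> \<partial>M)
        = (\<integral>\<omega>. (\<Sum>t=K+1..T. q (g, t) (paths \<omega>) * Y g 1 (zero_path T) \<omega>) \<partial>M)"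
      by (rule Bochner_Integration.integral_sum[symmetric]) (use that int_qY KT in auto)
    also have "\<dots> = 0"
      unfolding sum_distrib_right[symmetric] q_periods[OF that] by simp
    finally show ?thesis .
  qed
  have part2: "(\<Sum>g=1..G. \<integral>\<omega>. q (g, t) (paths \<omega>) \<partial>M) = 0" if "t \<in> {K+1..T}" for t
  proof -
    have "(\<Sum>g=1..G. \<integral>\<omega>. q (g, t) (paths \<omega>) \<partial>M) = (\<integral>\<omega>. (\<Sum>g=1..G. q (g, t) (paths \<omega>)) \<partial>M)"
      by (rule Bochner_Integration.integral_sum[symmetric]) (use that int_q in auto)
    then show ?thesis unfolding q_groups[OF that] by simp
  qed
  have "(\<integral>\<omega>. (\<Sum>s\<in>cells G T K. of_bool (\<forall>j\<in>cells G T K. \<bar>H j \<omega>\<bar> \<le> real n) * H s \<omega>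
        * Y (fst s) (snd s) (zero_path T) \<omega>) \<partial>M)
      = (\<integral>\<omega>. (\<Sum>s\<in>cells G T K. q s (paths \<omega>) * Y (fst s) (snd s) (zero_path T) \<omega>) \<partial>M)"
    unfolding q_def using H_paths
    by (intro Bochner_Integration.integral_cong refl sum.cong) simp
  also have "\<dots> = (\<Sum>s\<in>cells G T K. \<integral>\<omega>. q s (paths \<omega>) * Y (fst s) (snd s) (zero_path T) \<omega> \<partial>M)"
  proof (rule Bochner_Integration.integral_sum)
    fix s assume "s \<in> cells G T K"
    then have gt: "fst s \<in> {1..G}" "snd s \<in> {K+1..T}" by (auto simp: cells_def)
    from int_qY[OF this cell(2)[OF gt]]
    show "integrable M (\<lambda>\<omega>. q s (paths \<omega>) * Y (fst s) (snd s) (zero_path T) \<omega>)"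
      by (simp only: prod.collapse)
  qed
  also have "\<dots> = (\<Sum>g=1..G. \<Sum>t=K+1..T.
      (\<integral>\<omega>. q (g, t) (paths \<omega>) * Y g 1 (zero_path T) \<omega> \<partial>M) + m t * (\<integral>\<omega>. q (g, t) (paths \<omega>) \<partial>M))"
    unfolding sum_cells fst_conv snd_conv by (intro sum.cong refl mean_qY)
  also have "\<dots> = (\<Sum>g=1..G. \<Sum>t=K+1..T. \<integral>\<omega>. q (g, t) (paths \<omega>) * Y g 1 (zero_path T) \<omega> \<partial>M)
      + (\<Sum>g=1..G. \<Sum>t=K+1..T. m t * (\<integral>\<omega>. q (g, t) (paths \<omega>) \<partial>M))"
    unfolding sum.distrib ..
  also have "(\<Sum>g=1..G. \<Sum>t=K+1..T. \<integral>\<omega>. q (g, t) (paths \<omega>) * Y g 1 (zero_path T) \<omega> \<partial>M) = 0"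
    by (rule sum.neutral) (rule ballI, rule part1)
  also have "(\<Sum>g=1..G. \<Sum>t=K+1..T. m t * (\<integral>\<omega>. q (g, t) (paths \<omega>) \<partial>M))
      = (\<Sum>t=K+1..T. m t * (\<Sum>g=1..G. \<integral>\<omega>. q (g, t) (paths \<omega>) \<partial>M))"
    unfolding sum_distrib_left by (rule sum.swap)
  also have "\<dots> = 0"
    by (intro sum.neutral ballI) (simp only: part2 mult_zero_right)
  finally show "(\<integral>\<omega>. (\<Sum>s\<in>cells G T K. of_bool (\<forall>j\<in>cells G T K. \<bar>H j \<omega>\<bar> \<le> real n) * H s \<omega>
      * Y (fst s) (snd s) (zero_path T) \<omega>) \<partial>M) = 0"
    by simp
qed

text \<open>The model equation is inserted into the Frisch-Waugh-Lovell quotient. For each group,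
  the sum over periods of \<open>eta\<close> times lag \<open>k'\<close> is the denominator times
  \<open>W\<close>.\<close>

lemma AE_beta_hat_decomposition:
  assumes model: "random_coef_dl_model M T K D Y \<beta>" and k: "k \<le> K"
    and nz: "AE \<omega> in M. weight_denom G T K (\<lambda>g t. D g t \<omega>) k \<noteq> 0"
  shows "AE \<omega> in M. beta_hat G T K D Y k \<omega>
    = (\<Sum>s\<in>cells G T K. eta G T K (\<lambda>g t. D g t \<omega>) k (fst s) (snd s)
        / (real G * weight_denom G T K (\<lambda>g t. D g t \<omega>) k) * Y (fst s) (snd s) (zero_path T) \<omega>)
      + (\<Sum>g=1..G. \<Sum>k'=0..K. W G T K D k k' g \<omega> * \<beta> g k' \<omega>) / real G"
proof -
  have "AE \<omega> in M. \<forall>g\<in>{1..G}. \<forall>t\<in>{K+1..T}. observed_outcome T D Y g t \<omega>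
      = Y g t (zero_path T) \<omega> + (\<Sum>k=0..K. \<beta> g k \<omega> * D g (t - k) \<omega>)"
    by (rule AE_finite_allI) (use AE_observed_outcome[OF model] in auto)
  with nz show ?thesis
  proof eventually_elim
    case (elim \<omega>)
    define d where "d = weight_denom G T K (\<lambda>g t. D g t \<omega>) k"
    define e where "e = eta G T K (\<lambda>g t. D g t \<omega>) k"
    have "beta_hat G T K D Y k \<omega>
        = (\<Sum>g=1..G. \<Sum>t=K+1..T. e g t * observed_outcome T D Y g t \<omega>) / (real G * d)"
      unfolding beta_hat_def d_def e_def using k elim(1) by (rule dl_twfe_eq)
    also have "(\<Sum>g=1..G. \<Sum>t=K+1..T. e g t * observed_outcome T D Y g t \<omega>)
        = (\<Sum>g=1..G. \<Sum>t=K+1..T. e g t * Y g t (zero_path T) \<omega>)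
          + (\<Sum>g=1..G. \<Sum>t=K+1..T. e g t * (\<Sum>k'=0..K. \<beta> g k' \<omega> * D g (t - k') \<omega>))"
      unfolding sum.distrib[symmetric] distrib_left[symmetric]
      using elim(2) by (intro sum.cong refl) simp
    also have "(\<Sum>g=1..G. \<Sum>t=K+1..T. e g t * (\<Sum>k'=0..K. \<beta> g k' \<omega> * D g (t - k') \<omega>))
        = d * (\<Sum>g=1..G. \<Sum>k'=0..K. W G T K D k k' g \<omega> * \<beta> g k' \<omega>)"
    proof -
      have "(\<Sum>t=K+1..T. e g t * (\<Sum>k'=0..K. \<beta> g k' \<omega> * D g (t - k') \<omega>))
          = (\<Sum>k'=0..K. d * (W G T K D k k' g \<omega> * \<beta> g k' \<omega>))" for g
      proof -
        have "(\<Sum>t=K+1..T. e g t * (\<Sum>k'=0..K. \<beta> g k' \<omega> * D g (t - k') \<omega>))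
            = (\<Sum>k'=0..K. \<Sum>t=K+1..T. e g t * (\<beta> g k' \<omega> * D g (t - k') \<omega>))"
          unfolding sum_distrib_left by (rule sum.swap)
        also have "\<dots> = (\<Sum>k'=0..K. (\<Sum>t=K+1..T. e g t * D g (t - k') \<omega>) * \<beta> g k' \<omega>)"
          unfolding sum_distrib_right by (intro sum.cong refl) simp
        also have "\<dots> = (\<Sum>k'=0..K. d * (W G T K D k k' g \<omega> * \<beta> g k' \<omega>))"
          using elim(1) by (simp add: W_def weight_def d_def e_def)
        finally show ?thesis .
      qed
      then show ?thesis by (simp only: sum_distrib_left)
    qed
    finally have "beta_hat G T K D Y k \<omega>
        = (\<Sum>g=1..G. \<Sum>t=K+1..T. e g t * Y g t (zero_path T) \<omega>) / (real G * d)
          + (\<Sum>g=1..G. \<Sum>k'=0..K. W G T K D k k' g \<omega> * \<beta> g k' \<omega>) / real G"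
      using elim(1) G by (simp add: add_divide_distrib d_def)
    then show ?case
      by (simp add: sum_cells sum_divide_distrib d_def e_def)
  qed
qed

end

section \<open>Expectations of the estimator and of its weights\<close>

theorem theorem3:
  fixes M :: "'w measure"
    and G T K :: nat
    and D :: "nat \<Rightarrow> nat \<Rightarrow> 'w \<Rightarrow> real"
    and Y :: "nat \<Rightarrow> nat \<Rightarrow> (nat \<Rightarrow> real) \<Rightarrow> 'w \<Rightarrow> real"
    and \<beta> :: "nat \<Rightarrow> nat \<Rightarrow> 'w \<Rightarrow> real"
  assumes "prob_space M"
    and "K + 1 < T"
    and "no_anticipation M T D Y"
    and "iid_groups M T K D Y \<beta>"
    and "some_stayers M T D"
    and "parallel_trends M T D Y"
    and "random_coef_dl_model M T K D Y \<beta>"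
    and well_defined:
      "\<And>k. k \<le> K \<Longrightarrow> AE \<omega> in M. weight_denom G T K (\<lambda>g t. D g t \<omega>) k \<noteq> 0"
    and moments:
      "\<And>g t. g \<ge> 1 \<Longrightarrow> t \<in> {1..T} \<Longrightarrow> integrable M (Y g t (zero_path T))"
      "\<And>k. k \<le> K \<Longrightarrow> integrable M (beta_hat G T K D Y k)"
      "\<And>k k' g. k \<le> K \<Longrightarrow> k' \<le> K \<Longrightarrow> g \<in> {1..G} \<Longrightarrow> integrable M (W G T K D k k' g)"
      "\<And>k k' g. k \<le> K \<Longrightarrow> k' \<le> K \<Longrightarrow> g \<in> {1..G} \<Longrightarrow>
         integrable M (\<lambda>\<omega>. W G T K D k k' g \<omega> * \<beta> g k' \<omega>)"
  shows "\<forall>g\<in>{1..G}. \<forall>k\<in>{0..K}.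
      (\<integral>\<omega>. beta_hat G T K D Y k \<omega> \<partial>M) =
        (\<integral>\<omega>. W G T K D k k g \<omega> * \<beta> g k \<omega>
             + (\<Sum>k'\<in>{0..K} - {k}. W G T K D k k' g \<omega> * \<beta> g k' \<omega>) \<partial>M) \<and>
      (\<integral>\<omega>. W G T K D k k g \<omega> \<partial>M) = 1 \<and>
      (\<forall>k'\<in>{0..K} - {k}. (\<integral>\<omega>. W G T K D k k' g \<omega> \<partial>M) = 0) \<and>
      ((\<forall>k'\<in>{0..K}. cov M (W G T K D k k' g) (\<beta> g k') = 0) \<longrightarrow>
         (\<integral>\<omega>. beta_hat G T K D Y k \<omega> \<partial>M) = (\<integral>\<omega>. \<beta> g k \<omega> \<partial>M))"
proof (intro ballI)
  fix g k
  assume g: "g \<in> {1..G}" and "k \<in> {0..K}"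
  \<comment> \<open>The existence of a group \<open>g\<close> in \<open>{1..G}\<close> makes
    \<open>G\<close> positive, as the locale requires.\<close>
  then have k: "k \<le> K" and G: "1 \<le> G" by auto
  interpret iid_panel M G T K D Y \<beta>
    using assms G by (simp add: iid_panel_def iid_panel_axioms_def)
  \<comment> \<open>All groups share the same mean weight, so it can be read off from the sum over
    groups, which is known pointwise.\<close>
  have E_W: "real G * (\<integral>\<omega>. W G T K D k k' g \<omega> \<partial>M) = (\<integral>\<omega>. (\<Sum>i=1..G. W G T K D k k' i \<omega>) \<partial>M)"
    if "k' \<le> K" for k'
  proof -
    have "(\<integral>\<omega>. W G T K D k k' i \<omega> \<partial>M) = (\<integral>\<omega>. W G T K D k k' g \<omega> \<partial>M)" if "i \<in> {1..G}" for i
      using W_exchangeable[OF k \<open>k' \<le> K\<close> that, of "\<lambda>_. 1"] W_exchangeable[OF k \<open>k' \<le> K\<close> g, of "\<lambda>_. 1"]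
      by simp
    then show ?thesis
      using moments(3)[OF k \<open>k' \<le> K\<close>] by (subst Bochner_Integration.integral_sum) simp_all
  qed
  have E_W_own: "(\<integral>\<omega>. W G T K D k k g \<omega> \<partial>M) = 1"
  proof -
    have "AE \<omega> in M. (\<Sum>i=1..G. W G T K D k k i \<omega>) = real G"
      using well_defined[OF k] unfolding W_def by eventually_elim (rule sum_weight_own)
    then have "(\<integral>\<omega>. (\<Sum>i=1..G. W G T K D k k i \<omega>) \<partial>M) = (\<integral>\<omega>. real G \<partial>M)"
      using moments(3)[OF k k] by (intro integral_cong_AE borel_measurable_sum) auto
    then show ?thesis
      using E_W[OF k] G by (simp add: prob_space)
  qed
  have E_W_other: "(\<integral>\<omega>. W G T K D k k' g \<omega> \<partial>M) = 0" if "k' \<in> {0..K} - {k}" for k'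
    using E_W[of k'] that sum_weight_other[of k' K k] G by (simp add: W_def)
  have E_W\<beta>: "(\<integral>\<omega>. W G T K D k k' i \<omega> * \<beta> i k' \<omega> \<partial>M) = (\<integral>\<omega>. W G T K D k k' g \<omega> * \<beta> g k' \<omega> \<partial>M)"
    if "k' \<le> K" "i \<in> {1..G}" for k' i
    using W_exchangeable[OF k that coef_measurable[OF that(1)]]
      W_exchangeable[OF k that(1) g coef_measurable[OF that(1)]] that(1)
    by (simp add: coef_Z)
  define R where "R \<omega> = (\<Sum>s\<in>cells G T K. eta G T K (\<lambda>g t. D g t \<omega>) k (fst s) (snd s)
        / (real G * weight_denom G T K (\<lambda>g t. D g t \<omega>) k) * Y (fst s) (snd s) (zero_path T) \<omega>)" for \<omega>
  define S where "S \<omega> = (\<Sum>i=1..G. \<Sum>k'=0..K. W G T K D k k' i \<omega> * \<beta> i k' \<omega>) / real G" for \<omega>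
  have int_S: "integrable M S"
    unfolding S_def using moments(4)[OF k]
    by (intro integrable_divide_zero Bochner_Integration.integrable_sum) auto
  have decomp: "AE \<omega> in M. beta_hat G T K D Y k \<omega> = R \<omega> + S \<omega>"
    unfolding R_def S_def by (rule AE_beta_hat_decomposition[OF assms(7) k well_defined[OF k]])
  have R_meas: "R \<in> borel_measurable M"
    unfolding R_def
    by (intro borel_measurable_sum borel_measurable_times borel_measurable_divide borel_measurable_const
        eta_measurable weight_denom_measurable D_measurable borel_measurable_integrable moments(1))
      (use k in \<open>auto simp: cells_def\<close>)
  \<comment> \<open>Integrability of \<open>R\<close> is derived rather than assumed: almost surely
    it is the difference of two integrable variables.\<close>
  have "integrable M (\<lambda>\<omega>. beta_hat G T K D Y k \<omega> - S \<omega>)"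
    using moments(2)[OF k] int_S by simp
  then have int_R: "integrable M R"
    by (rule integrable_cong_AE_imp[OF _ R_meas]) (use decomp in eventually_elim, simp)
  have "(\<integral>\<omega>. R \<omega> \<partial>M) = 0"
    using integral_never_treated_part[OF assms(6) moments(1) k] int_R unfolding R_def by blast
  then have "(\<integral>\<omega>. beta_hat G T K D Y k \<omega> \<partial>M) = (\<integral>\<omega>. S \<omega> \<partial>M)"
    using integral_cong_AE[OF _ _ decomp] moments(2)[OF k] int_R int_S by simp
  also have "\<dots> = (\<Sum>i=1..G. \<integral>\<omega>. (\<Sum>k'=0..K. W G T K D k k' i \<omega> * \<beta> i k' \<omega>) \<partial>M) / real G"
    unfolding S_def integral_divide_zero using moments(4)[OF k]
    by (subst Bochner_Integration.integral_sum) auto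
  also have "\<dots> = (\<Sum>i=1..G. \<Sum>k'=0..K. \<integral>\<omega>. W G T K D k k' i \<omega> * \<beta> i k' \<omega> \<partial>M) / real G"
    using moments(4)[OF k]
    by (intro arg_cong2[where f = "(/)"] sum.cong refl Bochner_Integration.integral_sum) auto
  \<comment> \<open>By \<open>E_W\<beta>\<close> the \<open>G\<close> groups contribute equal terms,
    so their average is the term of the fixed group \<open>g\<close>.\<close>
  also have "\<dots> = (\<Sum>k'=0..K. \<integral>\<omega>. W G T K D k k' g \<omega> * \<beta> g k' \<omega> \<partial>M)"
    using G by (simp add: E_W\<beta>)
  finally have E_beta_hat: "(\<integral>\<omega>. beta_hat G T K D Y k \<omega> \<partial>M)
      = (\<Sum>k'=0..K. \<integral>\<omega>. W G T K D k k' g \<omega> * \<beta> g k' \<omega> \<partial>M)" .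
  also have "\<dots> = (\<integral>\<omega>. (\<Sum>k'=0..K. W G T K D k k' g \<omega> * \<beta> g k' \<omega>) \<partial>M)"
    using moments(4)[OF k _ g] by (simp add: Bochner_Integration.integral_sum)
  also have "\<dots> = (\<integral>\<omega>. W G T K D k k g \<omega> * \<beta> g k \<omega>
      + (\<Sum>k'\<in>{0..K} - {k}. W G T K D k k' g \<omega> * \<beta> g k' \<omega>) \<partial>M)"
    using k by (intro Bochner_Integration.integral_cong refl sum.remove) auto
  finally have "(\<integral>\<omega>. beta_hat G T K D Y k \<omega> \<partial>M) = \<dots>" .
  moreover have "(\<integral>\<omega>. beta_hat G T K D Y k \<omega> \<partial>M) = (\<integral>\<omega>. \<beta> g k \<omega> \<partial>M)"
    if cov0: "\<forall>k'\<in>{0..K}. cov M (W G T K D k k' g) (\<beta> g k') = 0"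
  proof -
    \<comment> \<open>Each squared coefficient is dominated by the integrable sum of squares, and on
      a probability space square integrability implies integrability.\<close>
    have "integrable M (\<beta> g k')" if "k' \<le> K" for k'
    proof -
      have m: "\<beta> g k' \<in> borel_measurable M"
        using assms(7) g that by (simp add: random_coef_dl_model_def)
      have "integrable M (\<lambda>\<omega>. \<Sum>i=0..K. (\<beta> g i \<omega>)\<^sup>2)"
        using assms(7) g by (simp add: random_coef_dl_model_def)
      then have "integrable M (\<lambda>\<omega>. (\<beta> g k' \<omega>)\<^sup>2)"
      proof (rule Bochner_Integration.integrable_bound)
        show "AE \<omega> in M. norm ((\<beta> g k' \<omega>)\<^sup>2) \<le> norm (\<Sum>i=0..K. (\<beta> g i \<omega>)\<^sup>2)"
          using that member_le_sum[of k' "{0..K}" "\<lambda>i. (\<beta> g i _)\<^sup>2"] by (simp add: sum_nonneg)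
      qed (use m in simp)
      with m show ?thesis
        by (rule square_integrable_imp_integrable)
    qed
    \<comment> \<open>Zero covariance factorizes each mean product; the mean weights 1 and 0 then
      single out the term of lag \<open>k\<close>.\<close>
    then have "(\<integral>\<omega>. W G T K D k k' g \<omega> * \<beta> g k' \<omega> \<partial>M)
        = (\<integral>\<omega>. W G T K D k k' g \<omega> \<partial>M) * (\<integral>\<omega>. \<beta> g k' \<omega> \<partial>M)" if "k' \<in> {0..K}" for k'
      using cov_eq[OF assms(1) moments(3)[OF k _ g] _ moments(4)[OF k _ g], of k'] cov0 that by simp
    then have "(\<integral>\<omega>. beta_hat G T K D Y k \<omega> \<partial>M)
        = (\<Sum>k'=0..K. (\<integral>\<omega>. W G T K D k k' g \<omega> \<partial>M) * (\<integral>\<omega>. \<beta> g k' \<omega> \<partial>M))"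
      unfolding E_beta_hat by simp
    also have "\<dots> = (\<integral>\<omega>. W G T K D k k g \<omega> \<partial>M) * (\<integral>\<omega>. \<beta> g k \<omega> \<partial>M)"
      using k E_W_other by (subst sum.remove[of _ k]) auto
    finally show ?thesis by (simp add: E_W_own)
  qed
  ultimately show "(\<integral>\<omega>. beta_hat G T K D Y k \<omega> \<partial>M) =
        (\<integral>\<omega>. W G T K D k k g \<omega> * \<beta> g k \<omega>
             + (\<Sum>k'\<in>{0..K} - {k}. W G T K D k k' g \<omega> * \<beta> g k' \<omega>) \<partial>M) \<and>
      (\<integral>\<omega>. W G T K D k k g \<omega> \<partial>M) = 1 \<and>
      (\<forall>k'\<in>{0..K} - {k}. (\<integral>\<omega>. W G T K D k k' g \<omega> \<partial>M) = 0) \<and>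
      ((\<forall>k'\<in>{0..K}. cov M (W G T K D k k' g) (\<beta> g k') = 0) \<longrightarrow>
         (\<integral>\<omega>. beta_hat G T K D Y k \<omega> \<partial>M) = (\<integral>\<omega>. \<beta> g k \<omega> \<partial>M))"
    using E_W_own E_W_other by blast
qed

end
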